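(* In the oligopoly setting described in the context, suppose that $f$ is symmetric (i.e. $f(t')=f(t)$ whenever $t'$ is a permutation of $t$) and log-concave. Then every consumer type $t\in T$ has a strictly higher payoff in the equilibrium $E_{\mathrm{simple}}$ of the simple evidence game, and a strictly higher payoff in the equilibrium $E_{\mathrm{rich}}$ of the rich evidence game, than in the benchmark setting without personalized pricing.
   Context: There are $n\ge2$ firms $N=\{1,\dots,n\}$ and one consumer with unit demand. Her type $t=(t_1,\dots,t_n)$ lists her value $t_i$ for each firm's product; $t$ is drawn from a distribution $\mu$ with support $T=[\underline t,\overline t]^n$, $0<\underline t<\overline t$, having a strictly positive continuous density $f$ on $T$. If she buys from firm $i$ at price $p_i$, her payoff is $t_i-p_i$ and firm $i$'s payoff is $p_i$; firms that do not sell get $0$. Benchmark without personalized pricing: the firms, with no information about $t$, simultaneously set uniform prices, and the consumer must purchase from exactly one firm and chooses her preferred one. The benchmark outcome is the symmetric pure-strategy equilibrium, in which each firm charges a common price $p^*$, i.e. $p=p^*$ maximizes $p\,\mu(\{t: t_i-p\ge\max_{j\ne i}t_j-p^*\})$ over $p\geq 0$; each type buys from a firm for which $t_i$ is highest. Disclosure games. Before prices are set, the consumer observes $t$ and privately sends each firm a message from $\mathcal M(t)$, where $\mathcal M(t)=\{T,\{t\}\}$ under simple evidence and $\mathcal M(t)$ is the set of all closed and convex subsets of $T$ containing $t$ under rich evidence; firms then simultaneously set prices $p_i\ge0$ given their own messages, and the consumer chooses which firm to buy from. The following are the (Perfect Bayesian) equilibria of these games being compared with the benchmark. $E_{\mathrm{simple}}$: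 let $Q^i(p)=\mu(\{t: t_i-p\ge\max_{j\ne i}t_j\})$ and let $p_1^i$ be the lowest maximizer of $pQ^i(p)$ over $p\ge0$. Type $t$ sends $\{t\}$ to firm $i$ if $t_i-p_1^i<\max_{j\ne i}t_j$ and sends $T$ to firm $i$ otherwise. Firm $i$ charges $\max\{0,t_i-\max_{j\ne i}t_j\}$ after message $\{t\}$ and $p_1^i$ after message $T$. Every type buys from a favorite firm (one with the highest $t_i$). $E_{\mathrm{rich}}$: let $\alpha(t)$ be type $t$'s favorite firm and $\beta(t)$ her favorite among the remaining firms (lowest index in case of ties). For Borel $A\subseteq T$ let $Q^i(p,A)=\mu(\{t\in A: t_i-p\ge\max_{j\ne i}t_j\})$. For distinct $i,j$ let $p_0^{ij}=\overline t-\underline t$ and, for $s\ge1$, $M_s^{ij}=\{t\in T: i=\alpha(t),\ j=\beta(t),\ t_i-t_j\le p_{s-1}^{ij}\}$, with $p_s^{ij}$ the smallest maximizer over $p\ge0$ of $pQ^i(p,M_s^{ij})$; let $M_\infty^{ij}=\{t\in T: i=\alpha(t),\ j=\beta(t),\ t_i=t_j\}$ and $p_\infty^{ij}=0$. A type $t\in M_s^{ij}$ with $t_i-t_j>p_s^{ij}$ sends $M_s^{ij}$ to all firms, and a type $t\in M_\infty^{ij}$ sends $M_\infty^{ij}$ to all firms; after $M_s^{ij}$ ($s\le\infty$), firm $i$ charges $p_s^{ij}$ and all other firms charge $0$. Every type buys from her favorite firm. *)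

theory Defs
  imports "HOL-Probability.Probability"
begin

text \<open>Firms are the elements of a finite linearly ordered type, the order serving only to break
  ties between equally liked firms. A consumer type is a vector of values, one per firm.\<close>

definition type_space :: "real \<Rightarrow> real \<Rightarrow> (real ^ 'n) set" where
  "type_space lo hi = cbox (\<chi> i. lo) (\<chi> i. hi)"

definition symmetric_on :: "(real ^ 'n) set \<Rightarrow> (real ^ 'n \<Rightarrow> real) \<Rightarrow> bool" where
  "symmetric_on T f \<longleftrightarrow> (\<forall>\<pi>. \<pi> permutes UNIV \<longrightarrow> (\<forall>t\<in>T. f (\<chi> i. t $ \<pi> i) = f t))"

definition best_rival :: "real ^ 'n \<Rightarrow> 'n \<Rightarrow> real" where
  "best_rival t i = (MAX j\<in>UNIV - {i}. t $ j)"

definition favorites :: "'n set \<Rightarrow> real ^ 'n \<Rightarrow> 'n set" where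
  "favorites A t = {i\<in>A. \<forall>j\<in>A. t $ j \<le> t $ i}"

definition alpha :: "real ^ 'n::{finite,linorder} \<Rightarrow> 'n::{finite,linorder}" where
  "alpha t = Min (favorites UNIV t)"

definition beta :: "real ^ 'n::{finite,linorder} \<Rightarrow> 'n::{finite,linorder}" where
  "beta t = Min (favorites (UNIV - {alpha t}) t)"

text \<open>Only meaningful when a least maximizer exists.\<close>

definition lowest_maximizer :: "(real \<Rightarrow> real) \<Rightarrow> real" where
  "lowest_maximizer g = (LEAST p. is_arg_max g (\<lambda>p. 0 \<le> p) p)"

definition benchmark_price :: "(real ^ 'n) measure \<Rightarrow> real \<Rightarrow> bool" where
  "benchmark_price \<mu> pstar \<longleftrightarrow>
     (\<forall>i. is_arg_max (\<lambda>p. p * measure \<mu> {t. t $ i - p \<ge> best_rival t i - pstar})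
            (\<lambda>p. 0 \<le> p) pstar)"

definition benchmark_payoff :: "real \<Rightarrow> (real ^ 'n \<Rightarrow> 'n) \<Rightarrow> real ^ 'n \<Rightarrow> real" where
  "benchmark_payoff pstar buy t = t $ buy t - pstar"

text \<open>\<open>message \<sigma> t i\<close> is the evidence type \<open>t\<close> sends to firm \<open>i\<close>, \<open>price \<sigma> i m\<close> is firm \<open>i\<close>'s
  price after evidence \<open>m\<close>, and \<open>buy \<sigma> t\<close> is the firm type \<open>t\<close> buys from on the path of play.\<close>

record ('n::finite) profile =
  message :: "real ^ 'n \<Rightarrow> 'n \<Rightarrow> (real ^ 'n) set"
  price :: "'n \<Rightarrow> (real ^ 'n) set \<Rightarrow> real"
  buy :: "real ^ 'n \<Rightarrow> 'n"

definition payoff :: "('n::finite) profile \<Rightarrow> real ^ 'n::finite \<Rightarrow> real" where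
  "payoff \<sigma> t = t $ buy \<sigma> t - price \<sigma> (buy \<sigma> t) (message \<sigma> t (buy \<sigma> t))"

definition demand :: "(real ^ 'n) measure \<Rightarrow> 'n \<Rightarrow> real \<Rightarrow> real" where
  "demand \<mu> i p = measure \<mu> {t. t $ i - p \<ge> best_rival t i}"

definition simple_price :: "(real ^ 'n) measure \<Rightarrow> 'n \<Rightarrow> real" where
  "simple_price \<mu> i = lowest_maximizer (\<lambda>p. p * demand \<mu> i p)"

definition E_simple ::
  "(real ^ 'n::finite) measure \<Rightarrow> real \<Rightarrow> real \<Rightarrow> ('n::finite) profile \<Rightarrow> bool" where
  "E_simple \<mu> lo hi \<sigma> \<longleftrightarrow>
     (\<forall>t\<in>type_space lo hi. \<forall>i. message \<sigma> t i =
        (if t $ i - simple_price \<mu> i < best_rival t i then {t} else type_space lo hi)) \<and>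
     (\<forall>t\<in>type_space lo hi. \<forall>i. price \<sigma> i {t} = max 0 (t $ i - best_rival t i)) \<and>
     (\<forall>i. price \<sigma> i (type_space lo hi) = simple_price \<mu> i) \<and>
     (\<forall>t\<in>type_space lo hi. buy \<sigma> t \<in> favorites UNIV t)"

definition demand_in :: "(real ^ 'n) measure \<Rightarrow> 'n \<Rightarrow> real \<Rightarrow> (real ^ 'n) set \<Rightarrow> real" where
  "demand_in \<mu> i p A = measure \<mu> {t\<in>A. t $ i - p \<ge> best_rival t i}"

definition rich_cell ::
  "real \<Rightarrow> real \<Rightarrow> 'n::{finite,linorder} \<Rightarrow> 'n::{finite,linorder} \<Rightarrow> real \<Rightarrow>
     (real ^ 'n::{finite,linorder}) set" where
  "rich_cell lo hi i j d =
     {t\<in>type_space lo hi. i = alpha t \<and> j = beta t \<and> t $ i - t $ j \<le> d}"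

primrec rich_price ::
  "(real ^ 'n::{finite,linorder}) measure \<Rightarrow> real \<Rightarrow> real \<Rightarrow>
     'n::{finite,linorder} \<Rightarrow> 'n::{finite,linorder} \<Rightarrow> nat \<Rightarrow> real" where
  "rich_price \<mu> lo hi i j 0 = hi - lo"
| "rich_price \<mu> lo hi i j (Suc s) =
     lowest_maximizer (\<lambda>p. p * demand_in \<mu> i p (rich_cell lo hi i j (rich_price \<mu> lo hi i j s)))"

text \<open>The message $M_s^{ij}$; used for \<open>s \<ge> 1\<close> only.\<close>

definition rich_msg ::
  "(real ^ 'n::{finite,linorder}) measure \<Rightarrow> real \<Rightarrow> real \<Rightarrow>
     'n::{finite,linorder} \<Rightarrow> 'n::{finite,linorder} \<Rightarrow> nat \<Rightarrow> (real ^ 'n::{finite,linorder}) set" where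
  "rich_msg \<mu> lo hi i j s = rich_cell lo hi i j (rich_price \<mu> lo hi i j (s - 1))"

text \<open>The message $M_\infty^{ij}$. It is empty when \<open>j < i\<close>, since \<open>alpha\<close> breaks ties in favor
  of the lower index.\<close>

definition rich_msg_inf ::
  "real \<Rightarrow> real \<Rightarrow> 'n::{finite,linorder} \<Rightarrow> 'n::{finite,linorder} \<Rightarrow> (real ^ 'n::{finite,linorder}) set" where
  "rich_msg_inf lo hi i j = {t\<in>type_space lo hi. i = alpha t \<and> j = beta t \<and> t $ i = t $ j}"

definition E_rich ::
  "(real ^ 'n::{finite,linorder}) measure \<Rightarrow> real \<Rightarrow> real \<Rightarrow> ('n::{finite,linorder}) profile \<Rightarrow> bool" where
  "E_rich \<mu> lo hi \<sigma> \<longleftrightarrow>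
     (\<forall>i j. i \<noteq> j \<longrightarrow>
        (\<forall>s\<ge>1. \<forall>t\<in>rich_msg \<mu> lo hi i j s. t $ i - t $ j > rich_price \<mu> lo hi i j s \<longrightarrow>
           (\<forall>k. message \<sigma> t k = rich_msg \<mu> lo hi i j s)) \<and>
        (\<forall>t\<in>rich_msg_inf lo hi i j. \<forall>k. message \<sigma> t k = rich_msg_inf lo hi i j) \<and>
        (\<forall>s\<ge>1. \<forall>k. price \<sigma> k (rich_msg \<mu> lo hi i j s) =
           (if k = i then rich_price \<mu> lo hi i j s else 0)) \<and>
        (\<forall>k. price \<sigma> k (rich_msg_inf lo hi i j) = 0)) \<and>
     (\<forall>t\<in>type_space lo hi. buy \<sigma> t = alpha t)"

end

theory Submission
  imports Defs
begin

text \<open>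
  Let \<open>V x\<close> be the probability that a given firm is the favorite, a given rival the runner-up, and the
  gap between their values is at least \<open>x\<close>. By symmetry \<open>V\<close> does not depend on the rival, so every
  uniform-price demand is proportional to \<open>V\<close>. The types with gap between \<open>a\<close> and \<open>b\<close> form a convex
  set depending affinely on \<open>(a, b)\<close>, so the Prekopa--Leindler inequality makes \<open>V a - V b\<close>
  log-concave in \<open>(a, b)\<close>. Since the gap is bounded, this forces the hazard rate of \<open>V\<close> to increase
  strictly. The first-order condition of the benchmark price \<open>P\<close> concerns the hazard rate at \<open>0\<close>,
  that of a maximizer \<open>q\<close> of \<open>p * V p\<close> the hazard rate at \<open>q\<close>; hence \<open>q < P\<close>. The prices in the
  rich evidence game decrease strictly from such a \<open>q\<close> to \<open>0\<close>, so every type is served at one of them.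
\<close>

section \<open>The Prekopa--Leindler inequality\<close>

lemma emeasure_lborel_translate:
  fixes A :: "real set"
  assumes "A \<in> sets borel"
  shows "(+) c ` A \<in> sets borel" "emeasure lborel ((+) c ` A) = emeasure lborel A"
proof -
  have eq: "(+) c ` A = (\<lambda>x. x - c) -` A \<inter> space borel"
  proof (intro set_eqI iffI)
    fix x assume "x \<in> (\<lambda>x. x - c) -` A \<inter> space borel"
    then show "x \<in> (+) c ` A" by (intro image_eqI[of _ _ "x - c"]) auto
  qed auto
  show m: "(+) c ` A \<in> sets borel" unfolding eq by (rule measurable_sets[OF _ assms]) simp
  have "emeasure lborel ((+) c ` A) = (\<integral>\<^sup>+x. indicator ((+) c ` A) x \<partial>lborel)"
    using m by simp
  also have "\<dots> = (\<integral>\<^sup>+x. indicator ((+) c ` A) (c + 1 * x) \<partial>lborel)"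
    using m by (subst nn_integral_real_affine[where c=1 and t=c]) auto
  also have "\<dots> = (\<integral>\<^sup>+x. indicator A x \<partial>lborel)"
    by (intro nn_integral_cong) (auto simp: indicator_def)
  finally show "emeasure lborel ((+) c ` A) = emeasure lborel A" using assms by simp
qed

text \<open>The sumset contains \<open>A\<close> shifted by a point \<open>b\<close> close to
  \<open>Inf B\<close> and \<open>B\<close> shifted by a point \<open>a\<close> close to
  \<open>Sup A\<close>. The first copy ends about where the second begins, so their overlap lies in
  an interval of length \<open>2 * d = e\<close>, and \<open>e\<close> is arbitrary.\<close>

lemma brunn_minkowski_real_bounded:
  fixes A B C :: "real set"
  assumes A: "A \<in> sets borel" "A \<noteq> {}" "bdd_above A"
    and B: "B \<in> sets borel" "B \<noteq> {}" "bdd_below B"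
    and C: "C \<in> sets borel" and sum: "\<And>x y. x \<in> A \<Longrightarrow> y \<in> B \<Longrightarrow> x + y \<in> C"
  shows "emeasure lborel A + emeasure lborel B \<le> emeasure lborel C"
proof (rule ennreal_le_epsilon)
  fix e :: real assume e: "e > 0"
  define d where "d = e / 2"
  have d: "d > 0" using e by (simp add: d_def)
  obtain a where a: "a \<in> A" "Sup A - d < a"
    using less_cSup_iff[OF A(2,3), of "Sup A - d"] d by (meson diff_less_eq less_add_same_cancel1)
  obtain b where b: "b \<in> B" "b < Inf B + d"
    using cInf_less_iff[OF B(2,3), of "Inf B + d"] d by (meson less_add_same_cancel1)
  let ?A = "(+) b ` A" and ?B = "(+) a ` B"
  have m: "?A \<in> sets borel" "?B \<in> sets borel" using emeasure_lborel_translate(1) A(1) B(1) by blast+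
  have "?A \<inter> ?B \<subseteq> {a + b - d..a + b + d}"
  proof
    fix z assume "z \<in> ?A \<inter> ?B"
    then obtain x y where z: "z = b + x" "x \<in> A" "z = a + y" "y \<in> B" by (elim IntE imageE)
    have "x \<le> Sup A" "Inf B \<le> y" using z A B by (simp_all add: cSup_upper cInf_lower)
    then show "z \<in> {a + b - d..a + b + d}" using a b z by simp
  qed
  then have "emeasure lborel (?A \<inter> ?B) \<le> emeasure lborel {a + b - d..a + b + d}"
    by (rule emeasure_mono) simp
  also have "\<dots> = ennreal e" using d by (simp add: d_def)
  finally have ov: "emeasure lborel (?A \<inter> ?B) \<le> ennreal e" .
  have "emeasure lborel A + emeasure lborel B = emeasure lborel ?A + emeasure lborel ?B"
    using emeasure_lborel_translate(2) A(1) B(1) by simp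
  also have "\<dots> = emeasure lborel (?A \<union> ?B) + emeasure lborel (?A \<inter> ?B)"
    by (rule emeasure_Un_Int) (use m in simp_all)
  also have "\<dots> \<le> emeasure lborel C + ennreal e"
  proof (intro add_mono emeasure_mono ov)
    show "?A \<union> ?B \<subseteq> C"
    proof
      fix z assume "z \<in> ?A \<union> ?B"
      then show "z \<in> C" using sum[OF _ b(1)] sum[OF a(1)] by (auto simp: add.commute[of b])
    qed
  qed (use C in simp)
  finally show "emeasure lborel A + emeasure lborel B \<le> emeasure lborel C + ennreal e" .
qed

lemma brunn_minkowski_real:
  fixes A B C :: "real set"
  assumes A: "A \<in> sets borel" "A \<noteq> {}" and B: "B \<in> sets borel" "B \<noteq> {}"
    and C: "C \<in> sets borel" and sum: "\<And>x y. x \<in> A \<Longrightarrow> y \<in> B \<Longrightarrow> x + y \<in> C"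
  shows "emeasure lborel A + emeasure lborel B \<le> emeasure lborel C"
proof -
  have lim: "(\<lambda>n. emeasure lborel (S \<inter> {- real n..real n})) \<longlonglongrightarrow> emeasure lborel S"
    if "S \<in> sets borel" for S :: "real set"
  proof -
    have "(\<lambda>n. emeasure lborel (S \<inter> {- real n..real n}))
        \<longlonglongrightarrow> emeasure lborel (\<Union>n. S \<inter> {- real n..real n})"
      using that by (intro Lim_emeasure_incseq) (auto simp: incseq_def)
    moreover have "(\<Union>n. S \<inter> {- real n..real n}) = S"
    proof -
      have "\<exists>n. x \<in> {- real n..real n}" for x
      proof -
        obtain n where "\<bar>x\<bar> \<le> real n" using real_arch_simple by blast
        then show ?thesis by (intro exI[of _ n]) auto
      qed
      then show ?thesis by blast
    qed
    ultimately show ?thesis by simp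
  qed
  obtain a b where ab: "a \<in> A" "b \<in> B" using A B by auto
  \<comment> \<open>From \<open>N\<close> on, the truncations of \<open>A\<close> and
    \<open>B\<close> contain \<open>a\<close> and \<open>b\<close>, so neither is empty.\<close>
  obtain N :: nat where N: "\<bar>a\<bar> + \<bar>b\<bar> \<le> real N" using real_arch_simple by blast
  show ?thesis
  proof (rule LIMSEQ_le_const2[OF tendsto_add[OF lim[OF A(1)] lim[OF B(1)]]], intro exI allI impI)
    fix n assume "N \<le> n"
    then have "a \<in> {- real n..real n}" "b \<in> {- real n..real n}" using N by auto
    then show "emeasure lborel (A \<inter> {- real n..real n}) + emeasure lborel (B \<inter> {- real n..real n})
        \<le> emeasure lborel C"
      using ab A B C sum
      by (intro brunn_minkowski_real_bounded) (auto intro: bdd_above_mono bdd_below_mono)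
  qed
qed

section \<open>Prekopa--Leindler on the real line\<close>

lemma nn_integral_layer_cake_le_one:
  fixes f :: "real \<Rightarrow> ennreal"
  assumes [measurable]: "f \<in> borel_measurable borel" and le: "\<And>x. f x \<le> 1"
  shows "(\<integral>\<^sup>+s. emeasure lborel {x. ennreal s < f x} * indicator {0<..<1} s \<partial>lborel) = (\<integral>\<^sup>+x. f x \<partial>lborel)"
proof -
  have "(\<integral>\<^sup>+x. f x \<partial>lborel) = (\<integral>\<^sup>+x. \<integral>\<^sup>+s. indicator {s. 0 < s \<and> s < 1 \<and> ennreal s < f x} s \<partial>lborel \<partial>lborel)"
  proof (rule nn_integral_cong)
    fix x :: real
    obtain r where r: "f x = ennreal r" "0 \<le> r" "r \<le> 1"
      using le[of x] by (cases "f x") (auto simp: top_unique)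
    have "{s. 0 < s \<and> s < 1 \<and> ennreal s < f x} = {0<..<r}"
      using r by (auto simp: ennreal_less_iff)
    then show "f x = (\<integral>\<^sup>+s. indicator {s. 0 < s \<and> s < 1 \<and> ennreal s < f x} s \<partial>lborel)"
      using r by simp
  qed
  also have "\<dots> = (\<integral>\<^sup>+s. \<integral>\<^sup>+x. indicator {s. 0 < s \<and> s < 1 \<and> ennreal s < f x} s \<partial>lborel \<partial>lborel)"
    by (rule lborel_pair.Fubini') (simp add: indicator_def)
  also have "\<dots> = (\<integral>\<^sup>+s. emeasure lborel {x. ennreal s < f x} * indicator {0<..<1} s \<partial>lborel)"
  proof (rule nn_integral_cong)
    fix s :: real
    have "(\<integral>\<^sup>+x. indicator {s. 0 < s \<and> s < 1 \<and> ennreal s < f x} s \<partial>lborel)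
        = (\<integral>\<^sup>+x. indicator {x. ennreal s < f x} x * indicator {0<..<1} s \<partial>lborel)"
      by (intro nn_integral_cong) (auto simp: indicator_def)
    also have "\<dots> = (\<integral>\<^sup>+x. indicator {x. ennreal s < f x} x \<partial>lborel) * indicator {0<..<1} s"
      by (rule nn_integral_multc) simp
    finally show "(\<integral>\<^sup>+x. indicator {s. 0 < s \<and> s < 1 \<and> ennreal s < f x} s \<partial>lborel)
        = emeasure lborel {x. ennreal s < f x} * indicator {0<..<1} s" by simp
  qed
  finally show ?thesis by simp
qed

text \<open>With both suprema equal to 1, the superlevel sets of \<open>f\<close> and
  \<open>g\<close> are nonempty at every level in the open unit interval. Brunn--Minkowski then
  compares them with that of \<open>h\<close> at the same level, and integrating over the level
  bounds the sum of the integrals.\<close>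

lemma prekopa_leindler_real_normalized:
  fixes f g h :: "real \<Rightarrow> ennreal"
  assumes [measurable]: "f \<in> borel_measurable borel" "g \<in> borel_measurable borel" "h \<in> borel_measurable borel"
    and f: "(SUP x. f x) = 1" and g: "(SUP x. g x) = 1"
    and fgh: "\<And>x y. f x * g y \<le> (h (x + y))\<^sup>2"
  shows "(\<integral>\<^sup>+x. f x \<partial>lborel) + (\<integral>\<^sup>+x. g x \<partial>lborel) \<le> (\<integral>\<^sup>+x. h x \<partial>lborel)"
proof -
  have f1: "f x \<le> 1" and g1: "g x \<le> 1" for x
    using f g by (metis SUP_upper UNIV_I)+
  \<comment> \<open>Cutting \<open>h\<close> off at 1 keeps its superlevel sets at levels below 1
    and makes the layer-cake formula applicable.\<close>
  define k where "k x = min 1 (h x)" for x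
  have [measurable]: "k \<in> borel_measurable borel" unfolding k_def by simp
  have bm: "emeasure lborel {x. ennreal s < f x} + emeasure lborel {x. ennreal s < g x}
      \<le> emeasure lborel {x. ennreal s < k x}" if s: "0 < s" "s < 1" for s
  proof (rule brunn_minkowski_real)
    have "ennreal s < (SUP x. f x)" "ennreal s < (SUP x. g x)"
      using s by (auto simp: f g ennreal_less_one_iff)
    then show "{x. ennreal s < f x} \<noteq> {}" "{x. ennreal s < g x} \<noteq> {}"
      by (auto simp: less_SUP_iff)
    fix x y assume A: "x \<in> {x. ennreal s < f x}" "y \<in> {x. ennreal s < g x}"
    have "ennreal s * ennreal s < f x * g y"
    proof -
      obtain r r' where r: "f x = ennreal r" "0 \<le> r" and r': "g y = ennreal r'" "0 \<le> r'"
        using f1[of x] g1[of y] by (cases "f x"; cases "g y") (auto simp: top_unique)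
      have "s < r" "s < r'" using A r r' s by (auto simp: ennreal_less_iff)
      then have "s * s < r * r'" using s by (intro mult_strict_mono) auto
      then show ?thesis using r r' s by (simp add: ennreal_less_iff flip: ennreal_mult)
    qed
    also have "\<dots> \<le> (h (x + y))\<^sup>2" by (rule fgh)
    finally have "ennreal s < h (x + y)"
      by (rule contrapos_pp) (auto simp: not_less power2_eq_square intro: mult_mono)
    then show "x + y \<in> {x. ennreal s < k x}" using s by (simp add: k_def ennreal_less_one_iff)
  qed measurable
  have "(\<integral>\<^sup>+x. f x \<partial>lborel) + (\<integral>\<^sup>+x. g x \<partial>lborel) =
     (\<integral>\<^sup>+s. emeasure lborel {x. ennreal s < f x} * indicator {0<..<1} s
         + emeasure lborel {x. ennreal s < g x} * indicator {0<..<1} s \<partial>lborel)"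
    using f1 g1 by (subst nn_integral_add) (auto simp: nn_integral_layer_cake_le_one)
  also have "\<dots> \<le> (\<integral>\<^sup>+s. emeasure lborel {x. ennreal s < k x} * indicator {0<..<1} s \<partial>lborel)"
    using bm by (intro nn_integral_mono) (auto simp: indicator_def)
  also have "\<dots> = (\<integral>\<^sup>+x. k x \<partial>lborel)"
    by (rule nn_integral_layer_cake_le_one) (auto simp: k_def)
  also have "\<dots> \<le> (\<integral>\<^sup>+x. h x \<partial>lborel)"
    by (intro nn_integral_mono) (simp add: k_def)
  finally show ?thesis .
qed

lemma ennreal_arith_geo_mean: "4 * (x * y) \<le> (x + y)\<^sup>2" for x y :: ennreal
proof (cases "x = \<top> \<or> y = \<top>")
  case True
  then show ?thesis by (auto simp: power2_eq_square)
next
  case False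
  then obtain a b where ab: "x = ennreal a" "0 \<le> a" "y = ennreal b" "0 \<le> b"
    by (cases x; cases y) auto
  have "4 * (a * b) \<le> (a + b)\<^sup>2"
    using zero_le_power2[of "a - b"] by (simp add: power2_eq_square algebra_simps)
  then have "ennreal (4 * (a * b)) \<le> ennreal ((a + b)\<^sup>2)" by (rule ennreal_leI)
  also have "ennreal (4 * (a * b)) = 4 * (x * y)"
    using ab by (simp add: ennreal_mult ennreal_numeral)
  also have "ennreal ((a + b)\<^sup>2) = (x + y)\<^sup>2"
    using ab by (simp add: ennreal_plus ennreal_power[symmetric])
  finally show ?thesis .
qed

lemma SUP_min_of_nat_ennreal: "(SUP n. min x (of_nat n)) = x" for x :: ennreal
proof (cases x)
  case (real r)
  obtain n where n: "r \<le> real n" using real_arch_simple by blast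
  then have "ennreal r \<le> of_nat n" by (simp add: ennreal_of_nat_eq_real_of_nat ennreal_leI)
  then have "x = min x (of_nat n)" using real by simp
  then show ?thesis by (intro antisym SUP_least) (auto intro: SUP_upper2[of n])
next
  case top
  then show ?thesis by (simp add: ennreal_SUP_of_nat_eq_top)
qed

text \<open>Scaling \<open>f\<close> and \<open>g\<close> to supremum 1 gives a bound on a sum of
  integrals, which the arithmetic-geometric mean inequality turns into a bound on their product.
  Boundedness keeps the suprema finite.\<close>

lemma prekopa_leindler_real_bounded:
  fixes f g h :: "real \<Rightarrow> ennreal"
  assumes [measurable]: "f \<in> borel_measurable borel" "g \<in> borel_measurable borel" "h \<in> borel_measurable borel"
    and f: "\<And>x. f x \<le> of_nat m" and g: "\<And>x. g x \<le> of_nat n"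
    and fgh: "\<And>x y. f x * g y \<le> (h ((x + y) / 2))\<^sup>2"
  shows "(\<integral>\<^sup>+x. f x \<partial>lborel) * (\<integral>\<^sup>+x. g x \<partial>lborel) \<le> (\<integral>\<^sup>+x. h x \<partial>lborel)\<^sup>2"
proof (cases "(SUP x. f x) = 0 \<or> (SUP x. g x) = 0")
  case True
  then have "(\<forall>x. f x = 0) \<or> (\<forall>x. g x = 0)" by (metis SUP_upper UNIV_I le_zero_eq)
  then show ?thesis by auto
next
  case False
  have "(SUP x. f x) \<le> of_nat m" "(SUP x. g x) \<le> of_nat n" using f g by (auto intro: SUP_least)
  then have "(SUP x. f x) < \<top>" "(SUP x. g x) < \<top>"
    by (auto simp: order.strict_trans1 of_nat_less_top)
  then obtain A B where AB: "(SUP x. f x) = ennreal A" "A > 0" "(SUP x. g x) = ennreal B" "B > 0"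
    using False by (cases "SUP x. f x"; cases "SUP x. g x") (auto simp: zero_less_iff_neq_zero order.order_iff_strict)
  \<comment> \<open>The factor \<open>c\<close> is the geometric mean of \<open>a\<close> and
    \<open>b\<close>, so scaling \<open>h\<close> by it preserves the pointwise hypothesis.\<close>
  define a b c where "a = ennreal (1 / A)" and "b = ennreal (1 / B)" and "c = ennreal (1 / sqrt (A * B))"
  have c2: "c\<^sup>2 = a * b"
    using AB by (simp add: a_def b_def c_def ennreal_power power_divide flip: ennreal_mult)
  have ab: "a * b \<noteq> 0" "a * b \<noteq> \<top>"
    using AB by (simp_all add: a_def b_def flip: ennreal_mult)
  let ?I = "\<lambda>u. \<integral>\<^sup>+x. u x \<partial>(lborel :: real measure)"
  have "?I (\<lambda>x. a * f x) + ?I (\<lambda>x. b * g x) \<le> ?I (\<lambda>z. c * h (z / 2))"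
  proof (rule prekopa_leindler_real_normalized)
    show "(SUP x. a * f x) = 1" "(SUP x. b * g x) = 1"
      using AB by (simp_all add: SUP_mult_left_ennreal[symmetric] a_def b_def flip: ennreal_mult)
    fix x y
    have "a * f x * (b * g y) = a * b * (f x * g y)" by (simp add: mult_ac)
    also have "\<dots> \<le> a * b * (h ((x + y) / 2))\<^sup>2" by (intro mult_left_mono fgh) simp
    finally show "a * f x * (b * g y) \<le> (c * h ((x + y) / 2))\<^sup>2"
      by (simp add: power_mult_distrib c2)
  qed measurable
  also have "?I (\<lambda>z. c * h (z / 2)) = c * ?I (\<lambda>z. h (z / 2))" by (rule nn_integral_cmult) measurable
  \<comment> \<open>Passing from midpoints to sums costs a factor 2, whose square cancels the 4 of
    the mean inequality below.\<close>
  also have "?I (\<lambda>z. h (z / 2)) = 2 * ?I h"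
    by (subst nn_integral_real_affine[where c=2 and t=0]) (auto simp: ennreal_numeral)
  finally have le: "a * ?I f + b * ?I g \<le> 2 * (c * ?I h)"
    by (simp add: nn_integral_cmult mult_ac)
  have "4 * (a * ?I f * (b * ?I g)) \<le> (a * ?I f + b * ?I g)\<^sup>2" by (rule ennreal_arith_geo_mean)
  also have "\<dots> \<le> (2 * (c * ?I h))\<^sup>2" using le by (intro power_mono) auto
  finally have "4 * (a * b) * (?I f * ?I g) \<le> 4 * (a * b) * (?I h)\<^sup>2"
    by (simp add: power_mult_distrib c2 mult_ac)
  then show ?thesis
    using ab by (subst (asm) ennreal_mult_le_mult_iff) (auto simp: ennreal_mult_eq_top_iff)
qed

lemma prekopa_leindler_real:
  fixes f g h :: "real \<Rightarrow> ennreal"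
  assumes [measurable]: "f \<in> borel_measurable borel" "g \<in> borel_measurable borel" "h \<in> borel_measurable borel"
    and fgh: "\<And>x y. f x * g y \<le> (h ((x + y) / 2))\<^sup>2"
  shows "(\<integral>\<^sup>+x. f x \<partial>lborel) * (\<integral>\<^sup>+x. g x \<partial>lborel) \<le> (\<integral>\<^sup>+x. h x \<partial>lborel)\<^sup>2"
proof -
  have trunc: "(\<integral>\<^sup>+x. u x \<partial>lborel) = (SUP n. \<integral>\<^sup>+x. min (u x) (of_nat n) \<partial>lborel)"
    if [measurable]: "u \<in> borel_measurable borel" for u :: "real \<Rightarrow> ennreal"
  proof -
    have "(SUP n. \<integral>\<^sup>+x. min (u x) (of_nat n) \<partial>lborel) = (\<integral>\<^sup>+x. (SUP n. min (u x) (of_nat n)) \<partial>lborel)"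
      by (rule nn_integral_monotone_convergence_SUP[symmetric])
        (auto simp: incseq_def le_fun_def intro: min.coboundedI2)
    then show ?thesis by (simp add: SUP_min_of_nat_ennreal)
  qed
  have "(\<integral>\<^sup>+x. min (f x) (of_nat m) \<partial>lborel) * (\<integral>\<^sup>+x. min (g x) (of_nat n) \<partial>lborel) \<le> (\<integral>\<^sup>+x. h x \<partial>lborel)\<^sup>2" for m n
    by (rule prekopa_leindler_real_bounded[of _ _ _ m n])
      (auto intro: order_trans[OF mult_mono fgh])
  then show ?thesis
    by (subst (1 2) trunc) (auto simp: SUP_mult_left_ennreal SUP_mult_right_ennreal intro!: SUP_least)
qed

section \<open>Prekopa--Leindler in several dimensions\<close>

lemma prekopa_leindler_PiM:
  fixes f g h :: "('i \<Rightarrow> real) \<Rightarrow> ennreal"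
  assumes "finite I"
    and "f \<in> borel_measurable (\<Pi>\<^sub>M i\<in>I. lborel)" "g \<in> borel_measurable (\<Pi>\<^sub>M i\<in>I. lborel)"
      "h \<in> borel_measurable (\<Pi>\<^sub>M i\<in>I. lborel)"
    and "\<And>x y. f x * g y \<le> (h (\<lambda>i\<in>I. (x i + y i) / 2))\<^sup>2"
  shows "(\<integral>\<^sup>+x. f x \<partial>(\<Pi>\<^sub>M i\<in>I. lborel)) * (\<integral>\<^sup>+x. g x \<partial>(\<Pi>\<^sub>M i\<in>I. lborel))
    \<le> (\<integral>\<^sup>+x. h x \<partial>(\<Pi>\<^sub>M i\<in>I. lborel))\<^sup>2"
  using assms
proof (induction I arbitrary: f g h rule: finite_induct)
  interpret product_sigma_finite "\<lambda>_. lborel :: real measure" by standard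
  case empty
  \<comment> \<open>The empty product has the single point \<open>\<lambda>_. undefined\<close>,
    where the claim is the hypothesis itself.\<close>
  show ?case using empty(4)[of "\<lambda>_. undefined" "\<lambda>_. undefined"]
    by (simp add: nn_integral_empty restrict_def)
next
  interpret product_sigma_finite "\<lambda>_. lborel :: real measure" by standard
  case (insert i I)
  note [measurable] = insert.prems(1-3)
  let ?M = "\<Pi>\<^sub>M i\<in>I. (lborel :: real measure)"
  interpret sigma_finite_measure ?M by (rule sigma_finite) fact
  have slice: "(\<lambda>x. u (x(i := a))) \<in> borel_measurable ?M"
    and marginal: "(\<lambda>a. \<integral>\<^sup>+x. u (x(i := a)) \<partial>?M) \<in> borel_measurable borel"
    if [measurable]: "u \<in> borel_measurable (\<Pi>\<^sub>M i\<in>insert i I. lborel)" for u :: "('i \<Rightarrow> real) \<Rightarrow> ennreal" and a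
    by measurable
  \<comment> \<open>The induction hypothesis, applied to slices, says that the marginals in
    coordinate \<open>i\<close> satisfy the hypothesis of the one-dimensional inequality.\<close>
  have "(\<integral>\<^sup>+a. \<integral>\<^sup>+x. f (x(i := a)) \<partial>?M \<partial>lborel) * (\<integral>\<^sup>+a. \<integral>\<^sup>+x. g (x(i := a)) \<partial>?M \<partial>lborel)
      \<le> (\<integral>\<^sup>+a. \<integral>\<^sup>+x. h (x(i := a)) \<partial>?M \<partial>lborel)\<^sup>2"
  proof (rule prekopa_leindler_real)
    fix a b :: real
    show "(\<integral>\<^sup>+x. f (x(i := a)) \<partial>?M) * (\<integral>\<^sup>+x. g (x(i := b)) \<partial>?M)
        \<le> (\<integral>\<^sup>+x. h (x(i := (a + b) / 2)) \<partial>?M)\<^sup>2"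
    proof (rule insert.IH)
      fix x y :: "'i \<Rightarrow> real"
      have "(\<lambda>k\<in>insert i I. ((x(i := a)) k + (y(i := b)) k) / 2)
          = (\<lambda>k\<in>I. (x k + y k) / 2)(i := (a + b) / 2)"
        using insert.hyps by (auto simp: fun_eq_iff)
      then show "f (x(i := a)) * g (y(i := b)) \<le> (h ((\<lambda>k\<in>I. (x k + y k) / 2)(i := (a + b) / 2)))\<^sup>2"
        using insert.prems(4)[of "x(i := a)" "y(i := b)"] by (simp only:)
    qed (rule slice insert.prems)+
  qed (auto intro: marginal)
  then show ?case
    using insert.hyps by (simp add: product_nn_integral_insert_rev)
qed

text \<open>The coordinate map along \<open>Basis\<close> carries the product measure to
  \<open>lborel\<close> and respects midpoints.\<close>

theorem prekopa_leindler:
  fixes f g h :: "'a::euclidean_space \<Rightarrow> ennreal"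
  assumes [measurable]: "f \<in> borel_measurable borel" "g \<in> borel_measurable borel" "h \<in> borel_measurable borel"
    and fgh: "\<And>x y. f x * g y \<le> (h ((1 / 2) *\<^sub>R (x + y)))\<^sup>2"
  shows "(\<integral>\<^sup>+x. f x \<partial>lborel) * (\<integral>\<^sup>+x. g x \<partial>lborel) \<le> (\<integral>\<^sup>+x. h x \<partial>lborel)\<^sup>2"
proof -
  let ?M = "\<Pi>\<^sub>M b\<in>(Basis :: 'a set). (lborel :: real measure)"
  let ?T = "\<lambda>x. \<Sum>b\<in>(Basis :: 'a set). x b *\<^sub>R b"
  have eq: "(\<integral>\<^sup>+x. u x \<partial>lborel) = (\<integral>\<^sup>+x. u (?T x) \<partial>?M)"
    if "u \<in> borel_measurable borel" for u :: "'a \<Rightarrow> ennreal"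
    using that by (subst lborel_eq) (simp add: nn_integral_distr)
  have "(\<integral>\<^sup>+x. f (?T x) \<partial>?M) * (\<integral>\<^sup>+x. g (?T x) \<partial>?M) \<le> (\<integral>\<^sup>+x. h (?T x) \<partial>?M)\<^sup>2"
  proof (rule prekopa_leindler_PiM)
    fix x y :: "'a \<Rightarrow> real"
    have "?T (\<lambda>b\<in>Basis. (x b + y b) / 2) = (1 / 2) *\<^sub>R (?T x + ?T y)"
      by (simp add: scaleR_right_distrib scaleR_sum_right add_divide_distrib scaleR_left_distrib
          flip: sum.distrib)
    then show "f (?T x) * g (?T y) \<le> (h (?T (\<lambda>b\<in>Basis. (x b + y b) / 2)))\<^sup>2"
      using fgh by simp
  qed auto
  then show ?thesis by (simp add: eq)
qed

section \<open>Prices for a log-concave survival function\<close>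

text \<open>The maximizers in \<open>{0..D}\<close> form a nonempty compact set, so there is a least
  one. Since points above \<open>D\<close> do no better than 0, it is also a maximizer among all
  nonnegative points.\<close>

lemma lowest_maximizer_is_arg_max:
  fixes g :: "real \<Rightarrow> real"
  assumes cont: "continuous_on {0..D} g" and D: "0 \<le> D" and tail: "\<And>p. D < p \<Longrightarrow> g p \<le> g 0"
  shows "is_arg_max g (\<lambda>p. 0 \<le> p) (lowest_maximizer g)"
proof -
  obtain q where q: "q \<in> {0..D}" "\<And>p. p \<in> {0..D} \<Longrightarrow> g p \<le> g q"
    using continuous_attains_sup[OF _ _ cont] D by auto
  define S where "S = {0..D} \<inter> g -` {g q}"
  have "closed S" unfolding S_def by (rule continuous_closed_preimage[OF cont]) auto
  then have "compact S" unfolding S_def by (metis compact_Icc compact_Int_closed inf_left_idem)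
  moreover have "S \<noteq> {}" using q by (auto simp: S_def)
  ultimately obtain r where r: "r \<in> S" "\<And>p. p \<in> S \<Longrightarrow> r \<le> p"
    using compact_attains_inf by metis
  have max: "g p \<le> g q" if "0 \<le> p" for p
    using q tail[of p] q(2)[of 0] D that by (cases "p \<le> D") (auto intro: order_trans)
  have "is_arg_max g (\<lambda>p. 0 \<le> p) r"
    using r max by (auto simp: is_arg_max_def S_def not_less)
  moreover have "r \<le> p" if "is_arg_max g (\<lambda>p. 0 \<le> p) p" for p
  proof (cases "p \<le> D")
    case True
    then have "p \<in> S" using that q max[of p] by (auto simp: is_arg_max_def S_def not_less intro: antisym)
    then show ?thesis by (rule r)
  next
    case False
    then show ?thesis using r by (auto simp: S_def)
  qed
  ultimately show ?thesis unfolding lowest_maximizer_def by (rule LeastI2_order) simp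
qed

text \<open>Ratios of successive terms decrease. The assumption on zeros excludes internal gaps: the
  sequence \<open>1, 0, 0, 1\<close> followed by zeros satisfies the other two, but not the
  conclusion at \<open>m = 1\<close>, \<open>k = 2\<close>.\<close>

lemma log_concave_seq_mult_le:
  fixes a :: "nat \<Rightarrow> real"
  assumes nonneg: "\<And>k. 0 \<le> a k" and lc: "\<And>k. a k * a (k + 2) \<le> (a (k + 1))\<^sup>2"
    and zero: "\<And>k l. a k = 0 \<Longrightarrow> k \<le> l \<Longrightarrow> a l = 0"
  shows "a 0 * a (m + k) \<le> a m * a k"
proof -
  have ratio: "a k * a (Suc l) \<le> a (Suc k) * a l" if "k \<le> l" for k l
    using that
  proof (induction l rule: dec_induct)
    case (step l)
    show ?case
    proof (cases "a l = 0")
      case True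
      then have "a (Suc (Suc l)) = 0" by (rule zero) simp
      then show ?thesis using nonneg by simp
    next
      case False
      then have pos: "a l > 0" using nonneg[of l] by simp
      have "a k * a (Suc (Suc l)) * a l = a k * (a l * a (l + 2))" by simp
      also have "\<dots> \<le> a k * (a (l + 1))\<^sup>2" by (intro mult_left_mono lc nonneg)
      also have "\<dots> = (a k * a (Suc l)) * a (Suc l)" by (simp add: power2_eq_square)
      also have "\<dots> \<le> (a (Suc k) * a l) * a (Suc l)" by (intro mult_right_mono step nonneg)
      finally have "a k * a (Suc (Suc l)) * a l \<le> (a (Suc k) * a (Suc l)) * a l" by (simp add: mult_ac)
      then show ?thesis using pos by simp
    qed
  qed simp
  show ?thesis
  proof (induction m)
    case (Suc m)
    show ?case
    proof (cases "a m = 0")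
      case True
      then have "a (Suc m + k) = 0" by (rule zero) simp
      then show ?thesis using nonneg by simp
    next
      case False
      then have pos: "a m > 0" using nonneg[of m] by simp
      have "a 0 * a (Suc m + k) * a m = a 0 * (a m * a (Suc (m + k)))" by (simp add: mult_ac)
      also have "\<dots> \<le> a 0 * (a (Suc m) * a (m + k))" by (intro mult_left_mono ratio nonneg) simp
      also have "\<dots> = a (Suc m) * (a 0 * a (m + k))" by simp
      also have "\<dots> \<le> a (Suc m) * (a m * a k)" by (intro mult_left_mono Suc nonneg)
      finally have "a 0 * a (Suc m + k) * a m \<le> (a (Suc m) * a k) * a m" by (simp add: mult_ac)
      then show ?thesis using pos by simp
    qed
  qed simp
qed

section \<open>Hazard rates and uniform prices\<close>

locale log_concave_survival =
  fixes V :: "real \<Rightarrow> real" and D :: real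
  assumes D_pos: "0 < D"
    and strict_dec: "\<And>x y. 0 \<le> x \<Longrightarrow> x < y \<Longrightarrow> y \<le> D \<Longrightarrow> V y < V x"
    and vanish: "\<And>x. D \<le> x \<Longrightarrow> V x = 0"
    and cont: "continuous_on UNIV V"
    and log_concave: "\<And>x y x' y'. 0 \<le> x \<Longrightarrow> x \<le> y \<Longrightarrow> 0 \<le> x' \<Longrightarrow> x' \<le> y' \<Longrightarrow>
      (V x - V y) * (V x' - V y') \<le> (V ((x + x') / 2) - V ((y + y') / 2))\<^sup>2"
begin

lemma V_pos: "0 \<le> x \<Longrightarrow> x < D \<Longrightarrow> 0 < V x"
  using strict_dec[of x D] vanish[of D] by simp

lemma V_nonneg: "0 \<le> x \<Longrightarrow> 0 \<le> V x"
  using V_pos[of x] vanish[of x] by (cases "x < D") auto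

lemma V_antimono: "0 \<le> x \<Longrightarrow> x \<le> y \<Longrightarrow> V y \<le> V x"
  using strict_dec[of x y] vanish[of y] V_nonneg[of x]
  by (cases "x = y"; cases "y \<le> D") auto

lemma V_tendsto: "(f \<longlongrightarrow> c) F \<Longrightarrow> ((\<lambda>x. V (f x)) \<longlongrightarrow> V c) F"
  using cont by (auto intro: continuous_on_tendsto_compose)

text \<open>The discrete hazard rate of \<open>V\<close> increases strictly: when the terms of \<open>V 0\<close> and of
  \<open>V (m * d)\<close> are compared pairwise, those of \<open>V 0\<close> near the end of the support have no partner.\<close>

lemma hazard_le:
  assumes d: "0 < d" and md: "real m * d \<le> D"
  shows "(V 0 - V d) * V (real m * d)
    \<le> (V (real m * d) - V (real (Suc m) * d)) * (V 0 - V (D - real m * d + d))"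
proof -
  \<comment> \<open>The half-line is cut into cells of width \<open>d\<close>; \<open>a k\<close> is
    the mass of cell \<open>k\<close>.\<close>
  define a where "a k = V (real k * d) - V (real (Suc k) * d)" for k
  have kd: "real k * d \<le> real l * d" if "k \<le> l" for k l using that d by simp
  have nonneg: "0 \<le> a k" for k unfolding a_def using V_antimono[of "real k * d"] kd[of k "Suc k"] d by simp
  have pos: "a k > 0" if "real k * d < D" for k
    using that strict_dec[of "real k * d" "real (Suc k) * d"] V_pos[of "real k * d"] vanish[of "real (Suc k) * d"] d
    by (cases "real (Suc k) * d \<le> D") (auto simp: a_def)
  have zero: "a l = 0" if "D \<le> real l * d" for l
    using that kd[of l "Suc l"] unfolding a_def by (simp only: vanish order_trans[OF that] diff_self)
  \<comment> \<open>\<open>K\<close> is the least number of cells covering the stretch from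
    \<open>m * d\<close> to \<open>D\<close>, so it overshoots by at most one width.\<close>
  define K where "K = nat \<lceil>(D - real m * d) / d\<rceil>"
  have K: "real (m + K) * d \<ge> D" "real K * d \<le> D - real m * d + d"
  proof -
    have "real K = of_int \<lceil>(D - real m * d) / d\<rceil>" using d md by (simp add: K_def)
    then have "(D - real m * d) / d \<le> real K" "real K \<le> (D - real m * d) / d + 1" by linarith+
    then show "real (m + K) * d \<ge> D" "real K * d \<le> D - real m * d + d" using d by (simp_all add: field_simps)
  qed
  have le: "a 0 * a (m + k) \<le> a m * a k" for k
  proof (rule log_concave_seq_mult_le[OF nonneg])
    \<comment> \<open>The endpoints of cell \<open>k + 1\<close> are the midpoints of those of cells
      \<open>k\<close> and \<open>k + 2\<close>, which is why log-concavity is assumed for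
      differences of \<open>V\<close>.\<close>
    show "a k * a (k + 2) \<le> (a (k + 1))\<^sup>2" for k
      using log_concave[of "real k * d" "real (Suc k) * d" "real (k + 2) * d" "real (Suc (k + 2)) * d"] d
      by (simp add: a_def algebra_simps add_divide_distrib)
    show "a l = 0" if "a k = 0" "k \<le> l" for k l
      using that pos[of k] kd[of k l] by (intro zero) linarith
  qed
  \<comment> \<open>The cells from \<open>m\<close> on reach \<open>D\<close>, where
    \<open>V\<close> vanishes, so their masses telescope to all of
    \<open>V (real m * d)\<close>.\<close>
  have "(V 0 - V d) * V (real m * d) = a 0 * (\<Sum>k<K. a (m + k))"
  proof -
    have "(\<Sum>k<K. a (m + k)) = V (real m * d) - V (real (m + K) * d)"
      using sum_lessThan_telescope'[of "\<lambda>k. V (real (m + k) * d)" K] by (simp add: a_def)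
    then show ?thesis using vanish[OF K(1)] by (simp add: a_def)
  qed
  also have "\<dots> \<le> a m * (\<Sum>k<K. a k)"
    unfolding sum_distrib_left by (intro sum_mono le)
  \<comment> \<open>The cells paired with them start at 0 and end at the latest at
    \<open>D - real m * d + d\<close>; the mass of \<open>V 0\<close> beyond that point is the
    strict gain.\<close>
  also have "(\<Sum>k<K. a k) = V 0 - V (real K * d)"
    using sum_lessThan_telescope'[of "\<lambda>k. V (real k * d)" K] by (simp add: a_def)
  also have "a m * (V 0 - V (real K * d)) \<le> a m * (V 0 - V (D - real m * d + d))"
    using V_antimono[OF _ K(2)] d nonneg by (intro mult_left_mono) auto
  finally show ?thesis by (simp add: a_def)
qed

text \<open>\<open>P\<close> is a best reply in uniform pricing when all rivals charge \<open>P\<close>.\<close>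

lemma maximizer_less_uniform_price:
  assumes q: "is_arg_max (\<lambda>p. p * V p) (\<lambda>p. 0 \<le> p) q"
    and P: "0 < P" "\<And>d. 0 \<le> d \<Longrightarrow> (P + d) * V d \<le> P * V 0"
  shows "q < P"
proof (rule ccontr)
  assume "\<not> q < P"
  then have Pq: "P \<le> q" by simp
  have max: "p * V p \<le> q * V q" if "0 \<le> p" for p
    using q that by (auto simp: is_arg_max_def not_less)
  \<comment> \<open>Some price earns a positive profit, which forces \<open>q < D\<close>.\<close>
  have "0 < D / 2 * V (D / 2)" using V_pos[of "D / 2"] D_pos by simp
  then have "0 < q * V q" using max[of "D / 2"] D_pos by linarith
  then have qD: "q < D" using vanish[of q] by (cases "q < D") auto
  have q0: "0 < q" using Pq P by simp
  \<comment> \<open>With this width \<open>q - d m\<close> and \<open>q\<close> are the grid points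
    \<open>m\<close> and \<open>m + 1\<close>.\<close>
  define d where "d m = q / real (Suc m)" for m
  have le: "V (d m) \<le> V 0 - V (D - q + 2 * d m)" for m
  proof -
    have d: "0 < d m" "d m \<le> q" using q0 by (simp_all add: d_def field_simps)
    have md: "real m * d m = q - d m" "real (Suc m) * d m = q"
      by (simp_all add: d_def field_simps)
    have pos: "0 < V (q - d m)" using V_pos d qD by simp
    have haz: "(V 0 - V (d m)) * V (q - d m) \<le> (V (q - d m) - V q) * (V 0 - V (D - q + 2 * d m))"
      using hazard_le[of "d m" m] d qD unfolding md by (simp add: algebra_simps)
    have W: "0 \<le> V 0 - V (D - q + 2 * d m)" using V_antimono[of 0 "D - q + 2 * d m"] d qD by simp
    \<comment> \<open>Optimality of \<open>P\<close> against \<open>P + d m\<close> bounds the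
      hazard near 0 from below, \<open>hazard_le\<close> carries this to \<open>q\<close>, and
      optimality of \<open>q\<close> against \<open>q - d m\<close> bounds the hazard there from
      above. The factor \<open>d m * V (q - d m)\<close> then cancels.\<close>
    have "d m * V (d m) * V (q - d m) \<le> (P * (V 0 - V (d m))) * V (q - d m)"
      using P(2)[of "d m"] d pos by (intro mult_right_mono) (auto simp: algebra_simps)
    also have "\<dots> \<le> P * ((V (q - d m) - V q) * (V 0 - V (D - q + 2 * d m)))"
      using haz P by (simp add: mult.assoc)
    also have "\<dots> \<le> q * ((V (q - d m) - V q) * (V 0 - V (D - q + 2 * d m)))"
      using Pq W V_antimono[of "q - d m" q] d by (intro mult_right_mono mult_nonneg_nonneg) auto
    also have "\<dots> = (q * (V (q - d m) - V q)) * (V 0 - V (D - q + 2 * d m))" by simp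
    also have "\<dots> \<le> (d m * V (q - d m)) * (V 0 - V (D - q + 2 * d m))"
      using max[of "q - d m"] d W by (intro mult_right_mono) (auto simp: algebra_simps)
    finally have "(d m * V (q - d m)) * V (d m) \<le> (d m * V (q - d m)) * (V 0 - V (D - q + 2 * d m))"
      by (simp add: mult_ac)
    then show ?thesis using d pos by (subst (asm) mult_le_cancel_left_pos) auto
  qed
  have lim: "d \<longlonglongrightarrow> 0" unfolding d_def
    by (rule LIMSEQ_Suc[OF lim_const_over_n])
  have "(\<lambda>m. V (d m)) \<longlonglongrightarrow> V 0" by (rule V_tendsto[OF lim])
  moreover have "(\<lambda>m. V 0 - V (D - q + 2 * d m)) \<longlonglongrightarrow> V 0 - V (D - q + 2 * 0)"
    by (intro tendsto_intros V_tendsto lim)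
  \<comment> \<open>The strict gain survives the limit as \<open>V (D - q)\<close>, which is
    positive because \<open>q > 0\<close>.\<close>
  ultimately have "V 0 \<le> V 0 - V (D - q + 2 * 0)" using le by (intro LIMSEQ_le) auto
  then show False using V_pos[of "D - q"] q0 qD by simp
qed

section \<open>Iterated price cutoffs\<close>

context
  fixes r :: "nat \<Rightarrow> real"
  assumes r0: "r 0 = D"
    and r_Suc: "\<And>s. is_arg_max (\<lambda>p. p * max 0 (V p - V (r s))) (\<lambda>p. 0 \<le> p) (r (Suc s))"
begin

lemma cutoff_max:
  "0 \<le> p \<Longrightarrow> p * max 0 (V p - V (r s)) \<le> r (Suc s) * max 0 (V (r (Suc s)) - V (r s))"
  using r_Suc[of s] by (auto simp: is_arg_max_def not_less)

text \<open>Half of the last cutoff earns positive revenue, hence so does the maximizer. This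
  excludes price 0 and every price at or above the last cutoff.\<close>

lemma cutoff_bounds: "0 < r s \<and> r s \<le> D"
  and cutoff_decreasing: "r (Suc s) < r s"
proof -
  have step: "0 < r (Suc s) \<and> r (Suc s) < r s" if rs: "0 < r s" "r s \<le> D" for s
  proof -
    have "0 < r s / 2 * max 0 (V (r s / 2) - V (r s))"
      using strict_dec[of "r s / 2" "r s"] rs by simp
    also have "\<dots> \<le> r (Suc s) * max 0 (V (r (Suc s)) - V (r s))"
      using rs by (intro cutoff_max) simp
    finally have pos: "0 < r (Suc s) * max 0 (V (r (Suc s)) - V (r s))" .
    have "0 \<le> r (Suc s)" using r_Suc[of s] by (simp add: is_arg_max_def)
    with pos have "0 < r (Suc s)" by (cases "r (Suc s) = 0") auto
    moreover have "V (r s) < V (r (Suc s))" using pos by (auto simp: zero_less_mult_iff max_def split: if_splits)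
    then have "r (Suc s) < r s" using V_antimono[of "r s" "r (Suc s)"] rs by (cases "r (Suc s) < r s") auto
    ultimately show ?thesis by simp
  qed
  have bounds: "0 < r s \<and> r s \<le> D" for s
  proof (induction s)
    case (Suc s)
    then show ?case using step[of s] by auto
  qed (use r0 D_pos in simp)
  then show "0 < r s \<and> r s \<le> D" "r (Suc s) < r s" using step by blast+
qed

text \<open>The cutoffs decrease to some \<open>l\<close>, and the maximal revenues tend to
  \<open>l * (V l - V l) = 0\<close>. If \<open>l\<close> were positive, the price
  \<open>l / 2\<close> would earn a positive amount in the limit.\<close>

lemma cutoff_tendsto_0: "r \<longlonglongrightarrow> 0"
proof -
  have "decseq r" using cutoff_decreasing by (intro decseq_SucI less_imp_le)
  then obtain l where l: "r \<longlonglongrightarrow> l" "\<And>i. l \<le> r i"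
    using decseq_convergent[of r 0] cutoff_bounds less_imp_le by metis
  have "0 \<le> l" using cutoff_bounds by (intro LIMSEQ_le_const[OF l(1)]) (auto intro: less_imp_le)
  moreover have "\<not> 0 < l"
  proof
    assume l0: "0 < l"
    have "l \<le> D" using l(2)[of 0] r0 by simp
    have "l / 2 * (V (l / 2) - V (r s)) \<le> r (Suc s) * (V (r (Suc s)) - V (r s))" for s
    proof -
      have "l / 2 * (V (l / 2) - V (r s)) \<le> l / 2 * max 0 (V (l / 2) - V (r s))"
        using l0 by (intro mult_left_mono) auto
      also have "\<dots> \<le> r (Suc s) * max 0 (V (r (Suc s)) - V (r s))"
        using l0 by (intro cutoff_max) simp
      also have "\<dots> = r (Suc s) * (V (r (Suc s)) - V (r s))"
        using V_antimono[of "r (Suc s)" "r s"] cutoff_bounds[of "Suc s"] cutoff_decreasing[of s] by simp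
      finally show ?thesis .
    qed
    moreover have "(\<lambda>s. l / 2 * (V (l / 2) - V (r s))) \<longlonglongrightarrow> l / 2 * (V (l / 2) - V l)"
      by (intro tendsto_intros V_tendsto l)
    moreover have "(\<lambda>s. r (Suc s) * (V (r (Suc s)) - V (r s))) \<longlonglongrightarrow> l * (V l - V l)"
      by (intro tendsto_intros V_tendsto l LIMSEQ_Suc)
    ultimately have "l / 2 * (V (l / 2) - V l) \<le> l * (V l - V l)" by (intro LIMSEQ_le) auto
    then show False using strict_dec[of "l / 2" l] l0 \<open>l \<le> D\<close> by (simp add: mult_le_0_iff)
  qed
  ultimately show ?thesis using l by simp
qed

text \<open>As \<open>V D = 0\<close>, the first cutoff maximizes \<open>p * V p\<close>, so the
  comparison with \<open>P\<close> applies to it; later cutoffs are smaller still.\<close>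

lemma cutoff_less_uniform_price:
  assumes P: "0 < P" "\<And>d. 0 \<le> d \<Longrightarrow> (P + d) * V d \<le> P * V 0"
  shows "r (Suc s) < P"
proof (induction s)
  case 0
  have "is_arg_max (\<lambda>p. p * V p) (\<lambda>p. 0 \<le> p) (r (Suc 0))"
    using r_Suc[of 0] vanish[of D] V_nonneg by (auto simp: is_arg_max_def r0 not_less)
  then show ?case using P by (rule maximizer_less_uniform_price)
next
  case (Suc s)
  then show ?case using cutoff_decreasing[of "Suc s"] by simp
qed

end

end

section \<open>The distribution of consumer types\<close>

text \<open>When the level tends to \<open>c\<close>, the indicators converge wherever
  \<open>Y x \<noteq> c\<close>, hence almost everywhere, and dominated convergence applies.\<close>

lemma (in finite_measure) continuous_measure_superlevel:
  fixes Y :: "'a \<Rightarrow> real"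
  assumes [measurable]: "Y \<in> borel_measurable M" "A \<in> sets M"
    and atomless: "\<And>c. AE x in M. Y x \<noteq> c"
  shows "continuous_on UNIV (\<lambda>c. measure M {x\<in>space M. x \<in> A \<and> c \<le> Y x})"
proof -
  let ?S = "\<lambda>c. {x\<in>space M. x \<in> A \<and> c \<le> Y x}"
  have "(\<lambda>n. measure M (?S (X n))) \<longlonglongrightarrow> measure M (?S c)" if X: "X \<longlonglongrightarrow> c" for X c
  proof -
    have "(\<lambda>n. \<integral>x. indicator (?S (X n)) x \<partial>M) \<longlonglongrightarrow> (\<integral>x. indicator (?S c) x \<partial>M :: real)"
    proof (rule integral_dominated_convergence[where w = "\<lambda>_. 1"])
      show "AE x in M. (\<lambda>n. indicator (?S (X n)) x) \<longlonglongrightarrow> (indicator (?S c) x :: real)"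
        using atomless[of c]
      proof eventually_elim
        fix x assume "Y x \<noteq> c"
        then have "\<forall>\<^sub>F n in sequentially. (X n \<le> Y x) = (c \<le> Y x)"
        proof (cases "c < Y x")
          case True
          then show ?thesis using order_tendstoD(2)[OF X True] by (auto elim: eventually_mono)
        next
          case False
          with \<open>Y x \<noteq> c\<close> have "Y x < c" by simp
          then show ?thesis using order_tendstoD(1)[OF X, of "Y x"] by (auto elim: eventually_mono)
        qed
        then have "\<forall>\<^sub>F n in sequentially. indicator (?S (X n)) x = (indicator (?S c) x :: real)"
          by eventually_elim (auto simp: indicator_def)
        then show "(\<lambda>n. indicator (?S (X n)) x) \<longlonglongrightarrow> (indicator (?S c) x :: real)"
          by (rule tendsto_eventually)
      qed
    qed (auto simp: indicator_def)
    then show ?thesis by simp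
  qed
  then show ?thesis
    by (auto simp: continuous_on_eq_continuous_at isCont_def tendsto_at_iff_sequentially o_def)
qed

lemma permute_vec_box:
  fixes l u :: "real ^ 'n"
  assumes "\<pi> permutes UNIV"
  shows "(\<lambda>t. \<chi> i. t $ \<pi> i) -` box l u = box (\<chi> i. l $ inv \<pi> i) (\<chi> i. u $ inv \<pi> i)"
proof (intro set_eqI iffI)
  fix t assume "t \<in> (\<lambda>t. \<chi> i. t $ \<pi> i) -` box l u"
  then have "\<And>i. l $ i < t $ \<pi> i \<and> t $ \<pi> i < u $ i" by (simp add: mem_box_cart)
  from this[of "inv \<pi> _"] show "t \<in> box (\<chi> i. l $ inv \<pi> i) (\<chi> i. u $ inv \<pi> i)"
    by (simp add: mem_box_cart permutes_inverses[OF assms])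
next
  fix t assume "t \<in> box (\<chi> i. l $ inv \<pi> i) (\<chi> i. u $ inv \<pi> i)"
  then have "\<And>i. l $ inv \<pi> i < t $ i \<and> t $ i < u $ inv \<pi> i" by (simp add: mem_box_cart)
  from this[of "\<pi> _"] show "t \<in> (\<lambda>t. \<chi> i. t $ \<pi> i) -` box l u"
    by (simp add: mem_box_cart permutes_inverses[OF assms])
qed

text \<open>\<open>lborel\<close> is determined by the volumes of boxes, and permuting coordinates
  only permutes side lengths.\<close>

lemma lborel_distr_permute_vec:
  assumes \<pi>: "\<pi> permutes UNIV"
  shows "distr lborel borel (\<lambda>t :: real ^ 'n. \<chi> i. t $ \<pi> i) = lborel"
proof (rule lborel_eqI[symmetric])
  have [measurable]: "(\<lambda>t :: real ^ 'n. \<chi> i. t $ \<pi> i) \<in> borel_measurable borel"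
    by (intro borel_measurable_continuous_onI continuous_intros)
  have basis: "(Basis :: (real ^ 'n) set) = range (\<lambda>i. axis i 1)" by (auto simp: Basis_vec_def)
  have prod_cart: "(\<Prod>b\<in>Basis. v \<bullet> b) = (\<Prod>i\<in>UNIV. v $ i)" for v :: "real ^ 'n"
    unfolding basis by (subst prod.reindex) (simp_all add: inner_axis inj_on_def axis_eq_axis)
  fix l u :: "real ^ 'n" assume le: "\<And>b. b \<in> Basis \<Longrightarrow> l \<bullet> b \<le> u \<bullet> b"
  then have lu: "\<And>i. l $ i \<le> u $ i"
    by (simp add: basis cart_eq_inner_axis)
  have "emeasure (distr lborel borel (\<lambda>t. \<chi> i. t $ \<pi> i)) (box l u)
      = emeasure lborel (box (\<chi> i. l $ inv \<pi> i) (\<chi> i. u $ inv \<pi> i))"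
    by (simp add: emeasure_distr permute_vec_box[OF \<pi>])
  also have "\<dots> = ennreal (\<Prod>i\<in>UNIV. (u - l) $ inv \<pi> i)"
  proof (subst emeasure_lborel_box)
    show "(\<chi> i. l $ inv \<pi> i) \<bullet> b \<le> (\<chi> i. u $ inv \<pi> i) \<bullet> b" if "b \<in> Basis" for b
      using that lu by (auto simp: basis inner_axis)
  qed (simp only: prod_cart vector_minus_component vec_lambda_beta)
  also have "(\<Prod>i\<in>UNIV. (u - l) $ inv \<pi> i) = (\<Prod>i\<in>UNIV. (u - l) $ i)"
    using prod.permute[OF permutes_inv[OF \<pi>], of "\<lambda>i. (u - l) $ i"] by (simp add: o_def)
  finally show "emeasure (distr lborel borel (\<lambda>t. \<chi> i. t $ \<pi> i)) (box l u) = ennreal (\<Prod>b\<in>Basis. (u - l) \<bullet> b)"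
    by (simp only: prod_cart)
qed simp

text \<open>The exceptional set is a hyperplane with normal
  \<open>axis i 1 - axis j 1\<close>.\<close>

lemma AE_lborel_coordinate_diff_neq:
  fixes i j :: "'n::finite"
  assumes "i \<noteq> j"
  shows "AE t in lborel. t $ i - t $ j \<noteq> (c :: real)"
proof -
  let ?S = "{t :: real ^ 'n. t $ i - t $ j = c}"
  have "?S = {t. (axis i 1 - axis j 1) \<bullet> t = c}"
    by (simp add: inner_diff_left inner_axis')
  moreover have "axis i 1 - axis j 1 \<noteq> (0 :: real ^ 'n)" using assms by (simp add: axis_eq_axis)
  ultimately have "negligible ?S" by (auto intro: negligible_hyperplane)
  then have "?S \<in> null_sets lebesgue" by (simp only: negligible_iff_null_sets)
  moreover have "?S \<in> sets lborel" by simp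
  ultimately have "?S \<in> null_sets lborel" using null_sets_completion_iff by blast
  then show ?thesis by (rule AE_I') auto
qed

section \<open>Favorite firms and tie-breaking\<close>

lemma exists_favorite:
  fixes A :: "'n::finite set"
  assumes "A \<noteq> {}"
  shows "\<exists>i\<in>A. \<forall>j\<in>A. t $ j \<le> (t $ i :: real)"
proof -
  have "Max ((\<lambda>j. t $ j) ` A) \<in> (\<lambda>j. t $ j) ` A" using assms by (intro Max_in) auto
  then obtain i where "i \<in> A" "Max ((\<lambda>j. t $ j) ` A) = t $ i" by auto
  moreover have "t $ j \<le> Max ((\<lambda>j. t $ j) ` A)" if "j \<in> A" for j using that by simp
  ultimately show ?thesis by auto
qed

text \<open>Spelled out as inequalities between coordinates, the conditions on \<open>alpha\<close>
  and \<open>beta\<close> visibly define Borel sets.\<close>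

lemma Min_favorites_eq_iff:
  fixes A :: "'n::{finite,linorder} set"
  assumes "A \<noteq> {}"
  shows "Min (favorites A t) = i \<longleftrightarrow> i \<in> A \<and> (\<forall>j\<in>A. t $ j \<le> t $ i \<and> (j < i \<longrightarrow> t $ j < t $ i))"
proof -
  have ne: "favorites A t \<noteq> {}" using exists_favorite[OF assms, of t] by (auto simp: favorites_def)
  then have "Min (favorites A t) = i \<longleftrightarrow> i \<in> favorites A t \<and> (\<forall>j\<in>favorites A t. i \<le> j)"
    by (subst eq_commute, subst eq_Min_iff) auto
  also have "\<dots> \<longleftrightarrow> i \<in> A \<and> (\<forall>j\<in>A. t $ j \<le> t $ i \<and> (j < i \<longrightarrow> t $ j < t $ i))"
  proof (intro iffI conjI ballI impI; (elim conjE)?)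
    fix j assume i: "i \<in> favorites A t" "\<forall>j\<in>favorites A t. i \<le> j" and j: "j \<in> A"
    show "t $ j \<le> t $ i" using i j by (auto simp: favorites_def)
    show "t $ j < t $ i" if "j < i"
    proof (rule ccontr)
      assume "\<not> t $ j < t $ i"
      then have "j \<in> favorites A t" using i j by (auto simp: favorites_def intro: order_trans)
      then show False using i that by auto
    qed
  next
    fix j assume i: "\<forall>j\<in>A. t $ j \<le> t $ i \<and> (j < i \<longrightarrow> t $ j < t $ i)" "i \<in> A" and "j \<in> favorites A t"
    then show "i \<le> j" by (auto simp: favorites_def not_less[symmetric])
  qed (auto simp: favorites_def)
  finally show ?thesis .
qed

lemma alpha_eq_iff: "alpha t = i \<longleftrightarrow> (\<forall>j. t $ j \<le> t $ i \<and> (j < i \<longrightarrow> t $ j < t $ i))"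
  by (simp add: alpha_def Min_favorites_eq_iff)

lemma rivals_nonempty:
  assumes "CARD('n::finite) \<ge> 2"
  shows "UNIV - {i :: 'n} \<noteq> {}"
proof
  assume "UNIV - {i} = {}"
  then have "(UNIV :: 'n set) = {i}" by auto
  then have "CARD('n) = 1" by (metis card_1_singleton_iff One_nat_def)
  then show False using assms by simp
qed

lemma alpha_beta_eq_iff:
  fixes i j :: "'n::{finite,linorder}"
  assumes "CARD('n) \<ge> 2"
  shows "alpha t = i \<and> beta t = j \<longleftrightarrow>
    (\<forall>k. t $ k \<le> t $ i \<and> (k < i \<longrightarrow> t $ k < t $ i)) \<and>
    j \<noteq> i \<and> (\<forall>k. k \<noteq> i \<longrightarrow> t $ k \<le> t $ j \<and> (k < j \<longrightarrow> t $ k < t $ j))"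
proof -
  have "alpha t = i \<and> beta t = j \<longleftrightarrow> alpha t = i \<and> Min (favorites (UNIV - {i}) t) = j"
    by (auto simp: beta_def)
  also have "\<dots> \<longleftrightarrow> (\<forall>k. t $ k \<le> t $ i \<and> (k < i \<longrightarrow> t $ k < t $ i)) \<and>
    j \<noteq> i \<and> (\<forall>k. k \<noteq> i \<longrightarrow> t $ k \<le> t $ j \<and> (k < j \<longrightarrow> t $ k < t $ j))"
    unfolding alpha_eq_iff Min_favorites_eq_iff[OF rivals_nonempty[OF assms]] by auto
  finally show ?thesis .
qed

lemma best_rival_le_iff:
  assumes "CARD('n::finite) \<ge> 2"
  shows "best_rival t i \<le> c \<longleftrightarrow> (\<forall>j. j \<noteq> i \<longrightarrow> t $ (j :: 'n) \<le> c)"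
  using rivals_nonempty[OF assms, of i] unfolding best_rival_def by (subst Max_le_iff) auto

section \<open>The type distribution and its null sets\<close>

locale oligopoly =
  fixes lo hi :: real and f :: "real ^ 'n::{finite,linorder} \<Rightarrow> real" and \<mu> :: "(real ^ 'n::{finite,linorder}) measure"
  assumes firms: "CARD('n::{finite,linorder}) \<ge> 2"
    and bounds: "0 < lo" "lo < hi"
    and f_pos: "\<forall>t\<in>type_space lo hi. 0 < f t"
    and f_cont: "continuous_on (type_space lo hi) f"
    and mu_density: "\<mu> = density lborel (\<lambda>t. ennreal (f t) * indicator (type_space lo hi) t)"
    and mu_prob: "prob_space \<mu>"
    and f_symmetric: "symmetric_on (type_space lo hi) f"
    and f_log_concave: "concave_on (type_space lo hi) (\<lambda>t. ln (f t))"
begin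

sublocale prob_space \<mu> by (rule mu_prob)

abbreviation T where "T \<equiv> type_space lo hi"
abbreviation weight where "weight t \<equiv> ennreal (f t) * indicator T t"

lemma mem_T_iff: "t \<in> T \<longleftrightarrow> (\<forall>i. lo \<le> t $ i \<and> t $ i \<le> hi)"
  by (simp add: type_space_def mem_box_cart)

lemma T_borel [measurable]: "T \<in> sets borel"
  by (simp add: type_space_def)

lemma sets_mu [measurable_cong, simp]: "sets \<mu> = sets borel"
  by (simp add: mu_density)

lemma space_mu [simp]: "space \<mu> = UNIV"
  by (simp add: mu_density)

lemma weight_measurable [measurable]: "weight \<in> borel_measurable borel"
proof -
  have "(\<lambda>t. indicator T t *\<^sub>R f t) \<in> borel_measurable borel"
    using f_cont by (intro borel_measurable_continuous_on_indicator) auto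
  then have "(\<lambda>t. ennreal (indicator T t *\<^sub>R f t)) \<in> borel_measurable borel" by measurable
  moreover have "(\<lambda>t. ennreal (indicator T t *\<^sub>R f t)) = weight" by (auto simp: indicator_def)
  ultimately show ?thesis by simp
qed

lemma emeasure_mu: "A \<in> sets borel \<Longrightarrow> emeasure \<mu> A = (\<integral>\<^sup>+t. weight t * indicator A t \<partial>lborel)"
  unfolding mu_density by (subst emeasure_density) auto

lemma AE_mu_iff: "(AE t in \<mu>. P t) \<longleftrightarrow> (AE t in lborel. t \<in> T \<longrightarrow> P t)"
proof -
  have "weight \<in> borel_measurable lborel" by simp
  then show ?thesis
    unfolding mu_density using f_pos
    by (subst AE_density) (auto simp: indicator_def intro!: AE_cong split: if_splits)
qed

lemma AE_in_T: "AE t in \<mu>. t \<in> T"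
  by (simp add: AE_mu_iff)

lemma AE_diff_neq: "i \<noteq> j \<Longrightarrow> AE t in \<mu>. t $ i - t $ j \<noteq> c"
  using AE_lborel_coordinate_diff_neq[of i j c] by (auto simp: AE_mu_iff)

lemma AE_no_ties: "AE t in \<mu>. \<forall>i j. i \<noteq> j \<longrightarrow> t $ i \<noteq> t $ j"
proof -
  have "AE t in \<mu>. i \<noteq> j \<longrightarrow> t $ i \<noteq> t $ j" for i j
    using AE_diff_neq[of i j 0] by (cases "i = j") auto
  then show ?thesis by (auto simp: AE_all_countable)
qed

text \<open>Since \<open>f\<close> is positive on \<open>T\<close>, a \<open>\<mu>\<close>-null open
  subset of \<open>T\<close> would be Lebesgue-null.\<close>

lemma measure_open_pos:
  assumes "open U" "U \<noteq> {}" "U \<subseteq> T"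
  shows "0 < measure \<mu> U"
proof (rule ccontr)
  assume "\<not> 0 < measure \<mu> U"
  then have "emeasure \<mu> U = 0" by (simp add: emeasure_eq_measure measure_nonneg order.antisym not_less)
  moreover have U: "U \<in> sets borel" using assms by simp
  ultimately have "AE t in \<mu>. t \<notin> U" by (subst AE_iff_measurable[OF _ refl]) auto
  then have "AE t in lborel. t \<notin> U" using assms(3) by (auto simp: AE_mu_iff elim: eventually_mono)
  then have "U \<in> null_sets lborel" using U by (subst (asm) AE_iff_null_sets[symmetric]) auto
  then have "negligible U" by (simp add: negligible_iff_null_sets null_sets_completionI)
  then show False using open_not_negligible assms by blast
qed

section \<open>The survival function of the gap\<close>

definition tail :: "'n \<Rightarrow> 'n \<Rightarrow> real \<Rightarrow> (real ^ 'n::{finite,linorder}) set" where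
  "tail i j x = {t. (\<forall>k. k \<noteq> i \<longrightarrow> t $ k \<le> t $ j) \<and> x \<le> t $ i - t $ j}"

text \<open>Weak inequalities replace the tie-breaking of \<open>alpha\<close> and
  \<open>beta\<close>: this keeps bands convex and affine in their bounds, at the cost of a null set
  of ties.\<close>

definition band :: "'n \<Rightarrow> 'n \<Rightarrow> real \<Rightarrow> real \<Rightarrow> (real ^ 'n::{finite,linorder}) set" where
  "band i j a b = {t. (\<forall>k. k \<noteq> i \<longrightarrow> t $ k \<le> t $ j) \<and> a \<le> t $ i - t $ j \<and> t $ i - t $ j \<le> b}"

lemma tail_borel [measurable]: "tail i j x \<in> sets borel"
  and band_borel [measurable]: "band i j a b \<in> sets borel"
  unfolding tail_def band_def by measurable

abbreviation V :: "'n \<Rightarrow> 'n \<Rightarrow> real \<Rightarrow> real" where "V i j x \<equiv> measure \<mu> (tail i j x)"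

lemma V_diff: "i \<noteq> j \<Longrightarrow> a \<le> b \<Longrightarrow> V i j a - V i j b = measure \<mu> (band i j a b)"
proof -
  assume ij: "i \<noteq> j" and ab: "a \<le> b"
  have "V i j a - V i j b = measure \<mu> (tail i j a - tail i j b)"
    using ab by (subst finite_measure_Diff) (auto simp: tail_def)
  also have "\<dots> = measure \<mu> (band i j a b)"
  proof (rule finite_measure_eq_AE)
    show "AE t in \<mu>. t \<in> tail i j a - tail i j b \<longleftrightarrow> t \<in> band i j a b"
      using AE_diff_neq[OF ij, of b] by eventually_elim (auto simp: tail_def band_def)
  qed auto
  finally show ?thesis .
qed

lemma band_midpoint:
  assumes "t \<in> band i j a b" "t' \<in> band i j a' b'"
  shows "(1 / 2) *\<^sub>R (t + t') \<in> band i j ((a + a') / 2) ((b + b') / 2)"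
  using assms by (auto simp: band_def field_simps intro: add_mono)

lemma T_midpoint: "t \<in> T \<Longrightarrow> t' \<in> T \<Longrightarrow> (1 / 2) *\<^sub>R (t + t') \<in> T"
  using convex_box(1)[of "\<chi> i. lo" "\<chi> i. hi"] convexD[of T t t' "1 / 2" "1 / 2"]
  by (simp add: type_space_def scaleR_right_distrib)

lemma f_midpoint:
  assumes t: "t \<in> T" "t' \<in> T"
  shows "f t * f t' \<le> (f ((1 / 2) *\<^sub>R (t + t')))\<^sup>2"
proof -
  let ?m = "(1 / 2) *\<^sub>R (t + t')"
  have pos: "0 < f t" "0 < f t'" "0 < f ?m" using f_pos t T_midpoint by auto
  have "(1 - 1 / 2) * ln (f t) + (1 / 2) * ln (f t') \<le> ln (f ((1 - 1 / 2) *\<^sub>R t + (1 / 2) *\<^sub>R t'))"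
    by (rule concave_onD[OF f_log_concave]) (use t in auto)
  then have "ln (f t * f t') \<le> ln ((f ?m)\<^sup>2)"
    using pos by (simp add: ln_mult ln_realpow scaleR_right_distrib)
  then show ?thesis using pos by simp
qed

text \<open>Prekopa--Leindler for the density restricted to the three bands. If either point lies
  outside its band or outside \<open>T\<close>, the left side of the pointwise hypothesis is 0;
  otherwise \<open>f_midpoint\<close> gives it.\<close>

lemma band_log_concave:
  "measure \<mu> (band i j a b) * measure \<mu> (band i j a' b')
    \<le> (measure \<mu> (band i j ((a + a') / 2) ((b + b') / 2)))\<^sup>2"
proof -
  let ?M = "\<lambda>A t. weight t * indicator A t"
  let ?B = "band i j a b" and ?B' = "band i j a' b'" and ?C = "band i j ((a + a') / 2) ((b + b') / 2)"
  have "(\<integral>\<^sup>+t. ?M ?B t \<partial>lborel) * (\<integral>\<^sup>+t. ?M ?B' t \<partial>lborel) \<le> (\<integral>\<^sup>+t. ?M ?C t \<partial>lborel)\<^sup>2"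
  proof (rule prekopa_leindler)
    fix t t'
    show "?M ?B t * ?M ?B' t' \<le> (?M ?C ((1 / 2) *\<^sub>R (t + t')))\<^sup>2"
    proof (cases "t \<in> T \<inter> ?B \<and> t' \<in> T \<inter> ?B'")
      case True
      then have "ennreal (f t * f t') \<le> ennreal ((f ((1 / 2) *\<^sub>R (t + t')))\<^sup>2)"
        by (intro ennreal_leI f_midpoint) auto
      then show ?thesis
        using True f_pos T_midpoint[of t t'] band_midpoint[of t i j a b t' a' b']
        by (simp add: ennreal_power less_imp_le flip: ennreal_mult)
    qed (auto simp: indicator_def)
  qed measurable
  then have "ennreal (measure \<mu> ?B) * ennreal (measure \<mu> ?B') \<le> (ennreal (measure \<mu> ?C))\<^sup>2"
    by (simp add: emeasure_mu flip: emeasure_eq_measure)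
  then show ?thesis by (simp add: ennreal_power flip: ennreal_mult)
qed

lemma V_strict_dec:
  assumes ij: "i \<noteq> j" and xy: "0 \<le> x" "x < y" "y \<le> hi - lo"
  shows "V i j y < V i j x"
proof -
  \<comment> \<open>The strict version of the band inside \<open>T\<close> is open, so one point in
    it gives the band positive mass.\<close>
  define U where "U = (\<Inter>k. {t :: real ^ 'n::{finite,linorder}. lo < t $ k \<and> t $ k < hi}) \<inter>
    (\<Inter>k\<in>UNIV - {i, j}. {t. t $ k < t $ j}) \<inter> {t. x < t $ i - t $ j \<and> t $ i - t $ j < y}"
  \<comment> \<open>The gap \<open>d\<close> lies between \<open>x\<close> and \<open>y\<close>. As
    \<open>4 * e\<close> is the room left beside it, the values \<open>lo + e\<close>,
    \<open>lo + 2 * e\<close> and \<open>lo + 2 * e + d = hi - 2 * e\<close> all lie strictly inside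
    the range.\<close>
  define d e where "d = (x + y) / 2" and "e = (hi - lo - d) / 4"
  have de: "x < d" "d < y" "0 < d" "d < hi - lo" "0 < e" "lo + 2 * e + d < hi"
    using xy by (auto simp: d_def e_def field_simps)
  have "open U"
    unfolding U_def by (intro open_Int open_INT ballI open_Collect_conj open_Collect_less continuous_intros) auto
  moreover have "(\<chi> k. if k = i then lo + 2 * e + d else if k = j then lo + 2 * e else lo + e) \<in> U"
    using de ij by (auto simp: U_def)
  moreover have "U \<subseteq> T" by (auto simp: U_def mem_T_iff less_imp_le)
  ultimately have "0 < measure \<mu> U" by (intro measure_open_pos) auto
  also have "measure \<mu> U \<le> measure \<mu> (band i j x y)"
  proof (rule finite_measure_mono)
    show "U \<subseteq> band i j x y"
    proof
      fix t assume t: "t \<in> U"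
      have "t $ k \<le> t $ j" if "k \<noteq> i" for k
        using t that by (cases "k = j") (auto simp: U_def less_imp_le)
      then show "t \<in> band i j x y" using t by (auto simp: U_def band_def)
    qed
  qed simp
  also have "\<dots> = V i j x - V i j y" using V_diff[OF ij, of x y] xy by simp
  finally show ?thesis by simp
qed

text \<open>On \<open>T\<close> the gap is at most \<open>hi - lo\<close>, with equality only on a
  null set.\<close>

lemma V_vanish:
  assumes ij: "i \<noteq> j" and x: "hi - lo \<le> x"
  shows "V i j x = 0"
proof -
  have "measure \<mu> (tail i j x) = measure \<mu> {}"
  proof (rule finite_measure_eq_AE)
    show "AE t in \<mu>. t \<in> tail i j x \<longleftrightarrow> t \<in> {}"
      using AE_in_T AE_diff_neq[OF ij, of "hi - lo"]
    proof eventually_elim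
      fix t assume "t \<in> T" "t $ i - t $ j \<noteq> hi - lo"
      then have "t $ i \<le> hi" "lo \<le> t $ j" by (auto simp: mem_T_iff)
      with \<open>t $ i - t $ j \<noteq> hi - lo\<close> show "t \<in> tail i j x \<longleftrightarrow> t \<in> {}" using x by (auto simp: tail_def)
    qed
  qed auto
  then show ?thesis by simp
qed

lemma V_survival: "i \<noteq> j \<Longrightarrow> log_concave_survival (V i j) (hi - lo)"
proof
  assume ij: "i \<noteq> j"
  show "0 < hi - lo" using bounds by simp
  show "V i j y < V i j x" if "0 \<le> x" "x < y" "y \<le> hi - lo" for x y
    using V_strict_dec ij that by blast
  show "V i j x = 0" if "hi - lo \<le> x" for x using V_vanish ij that by blast
  have "tail i j c = {t \<in> space \<mu>. t \<in> {t. \<forall>k. k \<noteq> i \<longrightarrow> t $ k \<le> t $ j} \<and> c \<le> t $ i - t $ j}" for c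
    by (auto simp: tail_def)
  then show "continuous_on UNIV (V i j)"
    using continuous_measure_superlevel[of "\<lambda>t. t $ i - t $ j" "{t. \<forall>k. k \<noteq> i \<longrightarrow> t $ k \<le> t $ j}"] AE_diff_neq[OF ij]
    by simp
  show "(V i j x - V i j y) * (V i j x' - V i j y') \<le> (V i j ((x + x') / 2) - V i j ((y + y') / 2))\<^sup>2"
    if "x \<le> y" "x' \<le> y'" for x y x' y'
    using band_log_concave[of i j x y x' y'] that by (simp add: V_diff[OF ij])
qed

text \<open>Both Lebesgue measure and the density restricted to \<open>T\<close> are invariant under
  permutations of the firms.\<close>

lemma measure_permute:
  assumes \<pi>: "\<pi> permutes UNIV" and A: "A \<in> sets borel"
  shows "measure \<mu> ((\<lambda>t. \<chi> k. t $ \<pi> k) -` A) = measure \<mu> A"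
proof -
  let ?P = "\<lambda>t :: real ^ 'n::{finite,linorder}. \<chi> k. t $ \<pi> k"
  have P [measurable]: "?P \<in> borel_measurable borel"
    by (intro borel_measurable_continuous_onI continuous_intros)
  have PA: "?P -` A \<in> sets borel" using measurable_sets[OF P A] by simp
  have w: "weight (?P t) = weight t" for t
  proof -
    have "?P t \<in> T \<longleftrightarrow> t \<in> T"
      unfolding mem_T_iff using permutes_surj[OF \<pi>] by (simp, metis surjD)
    then show ?thesis using f_symmetric \<pi> by (auto simp: symmetric_on_def indicator_def)
  qed
  have "emeasure \<mu> (?P -` A) = (\<integral>\<^sup>+t. weight (?P t) * indicator A (?P t) \<partial>lborel)"
    unfolding emeasure_mu[OF PA] w by (intro nn_integral_cong) (auto simp: indicator_def)
  also have "\<dots> = (\<integral>\<^sup>+t. weight t * indicator A t \<partial>distr lborel borel ?P)"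
    using A by (subst nn_integral_distr) auto
  also have "\<dots> = emeasure \<mu> A" unfolding lborel_distr_permute_vec[OF \<pi>] emeasure_mu[OF A] ..
  finally show ?thesis by (simp add: emeasure_eq_measure)
qed

text \<open>The transposition of \<open>j\<close> and \<open>j'\<close> fixes \<open>i\<close> and
  exchanges the two tails.\<close>

lemma V_runner_up_irrelevant:
  assumes "i \<noteq> j" "i \<noteq> j'"
  shows "V i j x = V i j' x"
proof -
  let ?\<pi> = "Transposition.transpose j j'"
  have "(\<lambda>t. \<chi> k. t $ ?\<pi> k) -` tail i j x = tail i j' x"
  proof (intro set_eqI)
    fix t :: "real ^ 'n::{finite,linorder}"
    have "(\<forall>k. k \<noteq> i \<longrightarrow> t $ ?\<pi> k \<le> t $ j') \<longleftrightarrow> (\<forall>k. k \<noteq> i \<longrightarrow> t $ k \<le> t $ j')"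
      using assms by (metis transpose_apply_other transpose_apply_first transpose_apply_second)
    then show "t \<in> (\<lambda>t. \<chi> k. t $ ?\<pi> k) -` tail i j x \<longleftrightarrow> t \<in> tail i j' x"
      using assms by (simp add: tail_def)
  qed
  then show ?thesis using measure_permute[of ?\<pi> "tail i j x"] by (simp add: permutes_swap_id)
qed

section \<open>Demand in terms of the survival function\<close>

lemma demand_set_eq: "{t. t $ (i :: 'n) - x \<ge> best_rival t i} = {t. \<forall>k. k \<noteq> i \<longrightarrow> t $ k \<le> t $ i - x}"
  by (simp add: best_rival_le_iff[OF firms])

text \<open>The buyers are split by their runner-up; by symmetry the pieces, one per rival, have
  equal mass.\<close>

lemma demand_eq:
  assumes ij: "i \<noteq> j"
  shows "demand \<mu> i x = real (CARD('n) - 1) * V i j x"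
proof -
  \<comment> \<open>Strict inequalities make the pieces disjoint. Apart from ties they cover the
    buyers and agree with the tails.\<close>
  define B where "B k = {t. (\<forall>l. l \<noteq> i \<and> l \<noteq> k \<longrightarrow> t $ l < t $ k) \<and> x \<le> t $ i - t $ k}" for k
  have B [measurable]: "B k \<in> sets borel" for k unfolding B_def by measurable
  have D: "{t. \<forall>k. k \<noteq> i \<longrightarrow> t $ k \<le> t $ i - x} \<in> sets borel" by measurable
  have "demand \<mu> i x = measure \<mu> (\<Union>k\<in>UNIV - {i}. B k)"
    unfolding demand_def demand_set_eq
  proof (rule finite_measure_eq_AE)
    show "AE t in \<mu>. t \<in> {t. \<forall>k. k \<noteq> i \<longrightarrow> t $ k \<le> t $ i - x} \<longleftrightarrow> t \<in> (\<Union>k\<in>UNIV - {i}. B k)"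
      using AE_no_ties
    proof eventually_elim
      fix t :: "real ^ 'n::{finite,linorder}" assume nt: "\<forall>i j. i \<noteq> j \<longrightarrow> t $ i \<noteq> t $ j"
      obtain m where m: "m \<noteq> i" and le: "\<And>k. k \<noteq> i \<Longrightarrow> t $ k \<le> t $ m"
        using exists_favorite[OF rivals_nonempty[OF firms, of i], of t] by auto
      show "t \<in> {t. \<forall>k. k \<noteq> i \<longrightarrow> t $ k \<le> t $ i - x} \<longleftrightarrow> t \<in> (\<Union>k\<in>UNIV - {i}. B k)"
      proof
        assume "t \<in> {t. \<forall>k. k \<noteq> i \<longrightarrow> t $ k \<le> t $ i - x}"
        then have "t \<in> B m" using le nt m by (auto simp: B_def order.order_iff_strict algebra_simps)
        then show "t \<in> (\<Union>k\<in>UNIV - {i}. B k)" using m by blast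
      next
        assume "t \<in> (\<Union>k\<in>UNIV - {i}. B k)"
        then obtain k where k: "k \<noteq> i" "t \<in> B k" by auto
        have "t $ l \<le> t $ i - x" if "l \<noteq> i" for l
        proof (cases "l = k")
          case False
          then have "t $ l < t $ k" "x \<le> t $ i - t $ k" using k that by (auto simp: B_def)
          then show ?thesis by linarith
        qed (use k in \<open>auto simp: B_def\<close>)
        then show "t \<in> {t. \<forall>k. k \<noteq> i \<longrightarrow> t $ k \<le> t $ i - x}" by simp
      qed
    qed
  qed (use D in auto)
  also have "\<dots> = (\<Sum>k\<in>UNIV - {i}. measure \<mu> (B k))"
  proof (rule finite_measure_finite_Union)
    show "disjoint_family_on B (UNIV - {i})"
      unfolding disjoint_family_on_def
    proof (intro ballI impI)
      fix k l assume "k \<in> UNIV - {i}" "l \<in> UNIV - {i}" "k \<noteq> l"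
      then have "t $ l < t $ k" if "t \<in> B k" for t using that by (auto simp: B_def)
      moreover have "t $ k < t $ l" if "t \<in> B l" for t
        using that \<open>k \<in> UNIV - {i}\<close> \<open>k \<noteq> l\<close> by (auto simp: B_def)
      ultimately show "B k \<inter> B l = {}" by force
    qed
  qed auto
  also have "\<dots> = (\<Sum>k\<in>UNIV - {i}. V i j x)"
  proof (rule sum.cong[OF refl])
    fix k assume k: "k \<in> UNIV - {i}"
    have "measure \<mu> (B k) = V i k x"
    proof (rule finite_measure_eq_AE)
      show "AE t in \<mu>. t \<in> B k \<longleftrightarrow> t \<in> tail i k x"
        using AE_no_ties
      proof eventually_elim
        fix t :: "real ^ 'n::{finite,linorder}" assume "\<forall>i j. i \<noteq> j \<longrightarrow> t $ i \<noteq> t $ j"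
        then have "(l \<noteq> k \<longrightarrow> t $ l < t $ k) \<longleftrightarrow> t $ l \<le> t $ k" for l
          by (cases "l = k") (auto simp: order.order_iff_strict)
        then show "t \<in> B k \<longleftrightarrow> t \<in> tail i k x" by (auto simp: B_def tail_def)
      qed
    qed auto
    also have "V i k x = V i j x" using k ij by (intro V_runner_up_irrelevant) auto
    finally show "measure \<mu> (B k) = V i j x" .
  qed
  also have "\<dots> = real (CARD('n) - 1) * V i j x" by (simp add: card_Diff_singleton)
  finally show ?thesis .
qed

text \<open>Up to ties, the buyers in the cell form a band. The \<open>max 0\<close> covers
  \<open>p > d\<close>, where nobody in the cell buys.\<close>

lemma demand_in_rich_cell:
  assumes ij: "i \<noteq> j" and p: "0 \<le> p" and d: "0 \<le> d"
  shows "demand_in \<mu> i p (rich_cell lo hi i j d) = max 0 (V i j p - V i j d)"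
proof -
  have "demand_in \<mu> i p (rich_cell lo hi i j d) = measure \<mu> (band i j p d)"
    unfolding demand_in_def
  proof (rule finite_measure_eq_AE)
    have "{t \<in> rich_cell lo hi i j d. best_rival t i \<le> t $ i - p} =
      {t. t \<in> T \<and> (alpha t = i \<and> beta t = j) \<and> t $ i - t $ j \<le> d \<and>
        (\<forall>k. k \<noteq> i \<longrightarrow> t $ k \<le> t $ i - p)}"
      by (auto simp: rich_cell_def best_rival_le_iff[OF firms])
    also have "\<dots> \<in> sets borel" unfolding alpha_beta_eq_iff[OF firms] by measurable
    finally show "{t \<in> rich_cell lo hi i j d. best_rival t i \<le> t $ i - p} \<in> sets \<mu>" by simp
    show "AE t in \<mu>. t \<in> {t \<in> rich_cell lo hi i j d. best_rival t i \<le> t $ i - p} \<longleftrightarrow> t \<in> band i j p d"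
      using AE_in_T AE_no_ties
    proof eventually_elim
      fix t :: "real ^ 'n::{finite,linorder}"
      assume t: "t \<in> T" and nt: "\<forall>i j. i \<noteq> j \<longrightarrow> t $ i \<noteq> t $ j"
      show "t \<in> {t \<in> rich_cell lo hi i j d. best_rival t i \<le> t $ i - p} \<longleftrightarrow> t \<in> band i j p d"
      proof
        assume "t \<in> {t \<in> rich_cell lo hi i j d. best_rival t i \<le> t $ i - p}"
        then have ab: "alpha t = i \<and> beta t = j" and "t $ i - t $ j \<le> d" "best_rival t i \<le> t $ i - p"
          by (auto simp: rich_cell_def)
        then show "t \<in> band i j p d"
          using ij unfolding alpha_beta_eq_iff[OF firms] best_rival_le_iff[OF firms] by (auto simp: band_def algebra_simps)
      next
        assume "t \<in> band i j p d"
        then have le: "\<And>k. k \<noteq> i \<Longrightarrow> t $ k \<le> t $ j" and "p \<le> t $ i - t $ j" "t $ i - t $ j \<le> d"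
          by (auto simp: band_def)
        then have le': "t $ k \<le> t $ i - p" if "k \<noteq> i" for k using that[THEN le] by linarith
        have lt: "t $ k < t $ i" if "k \<noteq> i" for k
          using le'[OF that] p nt[rule_format, OF that] by linarith
        have lt': "t $ k < t $ j" if "k \<noteq> i" "k \<noteq> j" for k
          using le[OF that(1)] nt[rule_format, OF that(2)] by linarith
        have "alpha t = i \<and> beta t = j"
          unfolding alpha_beta_eq_iff[OF firms]
        proof (intro conjI allI impI)
          show "t $ k \<le> t $ i" for k using lt[of k] by (cases "k = i") auto
        qed (use lt lt' le ij in auto)
        then show "t \<in> {t \<in> rich_cell lo hi i j d. best_rival t i \<le> t $ i - p}"
          using t \<open>t $ i - t $ j \<le> d\<close> le' by (auto simp: rich_cell_def best_rival_le_iff[OF firms])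
      qed
    qed
  qed simp
  also have "\<dots> = max 0 (V i j p - V i j d)"
  proof (cases "p \<le> d")
    case True
    then show ?thesis using V_diff[OF ij True] measure_nonneg[of \<mu> "band i j p d"] by linarith
  next
    case False
    then have "band i j p d = {}" by (auto simp: band_def)
    then show ?thesis
      using False d log_concave_survival.V_antimono[OF V_survival[OF ij], of d p] by simp
  qed
  finally show ?thesis .
qed

section \<open>Equilibrium prices against the benchmark price\<close>

lemma exists_rival: obtains j where "j \<noteq> (i :: 'n)"
  using rivals_nonempty[OF firms, of i] by blast

text \<open>Demand at price \<open>p\<close> against rivals charging \<open>P\<close> is demand at
  \<open>p - P\<close> against rivals charging 0. The number of rivals is then a common factor and
  cancels.\<close>

lemma benchmark_price_V:
  assumes "benchmark_price \<mu> P" and ij: "i \<noteq> j" and "0 \<le> P + d"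
  shows "(P + d) * V i j d \<le> P * V i j 0"
proof -
  have demand: "measure \<mu> {t. t $ i - p \<ge> best_rival t i - P} = real (CARD('n) - 1) * V i j (p - P)" for p
    unfolding demand_eq[OF ij, symmetric] demand_def by (intro arg_cong[where f = "measure \<mu>"] Collect_cong) linarith
  have "is_arg_max (\<lambda>p. p * (real (CARD('n) - 1) * V i j (p - P))) (\<lambda>p. 0 \<le> p) P"
    using assms(1) unfolding benchmark_price_def demand[symmetric] by (rule spec)
  then have "(P + d) * (real (CARD('n) - 1) * V i j (P + d - P)) \<le> P * (real (CARD('n) - 1) * V i j (P - P))"
    using assms(3) unfolding is_arg_max_def by (metis not_less)
  then have "real (CARD('n) - 1) * ((P + d) * V i j d) \<le> real (CARD('n) - 1) * (P * V i j 0)"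
    by (simp add: mult.left_commute)
  then show ?thesis using firms by (subst (asm) mult_le_cancel_left_pos) auto
qed

text \<open>At \<open>P = 0\<close> profit is zero, while deviating to half the maximal gap would
  earn a positive profit.\<close>

lemma benchmark_price_pos:
  assumes "benchmark_price \<mu> P"
  shows "0 < P"
proof -
  fix i :: 'n
  obtain j where "j \<noteq> i" by (rule exists_rival)
  then have ij: "i \<noteq> j" by simp
  interpret V: log_concave_survival "V i j" "hi - lo" by (rule V_survival[OF ij])
  have "0 \<le> P" using assms by (simp add: benchmark_price_def is_arg_max_def)
  moreover have "P \<noteq> 0"
  proof
    assume "P = 0"
    then have "(hi - lo) / 2 * V i j ((hi - lo) / 2) \<le> 0"
      using benchmark_price_V[OF assms ij, of "(hi - lo) / 2"] bounds by simp
    moreover have "0 < (hi - lo) / 2 * V i j ((hi - lo) / 2)" using bounds V.V_pos by simp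
    ultimately show False by simp
  qed
  ultimately show ?thesis by simp
qed

text \<open>Up to a positive factor, \<open>simple_price\<close> maximizes
  \<open>p * V i j p\<close> for any rival \<open>j\<close>.\<close>

lemma simple_price_less_benchmark:
  assumes P: "benchmark_price \<mu> P"
  shows "simple_price \<mu> i < P"
proof -
  obtain j where "j \<noteq> i" by (rule exists_rival)
  then have ij: "i \<noteq> j" by simp
  interpret V: log_concave_survival "V i j" "hi - lo" by (rule V_survival[OF ij])
  define c where "c = real (CARD('n) - 1)"
  have c: "c > 0" using firms by (simp add: c_def)
  let ?q = "simple_price \<mu> i"
  have q: "?q = lowest_maximizer (\<lambda>p. p * (c * V i j p))"
    unfolding simple_price_def demand_eq[OF ij] c_def ..
  have "is_arg_max (\<lambda>p. p * (c * V i j p)) (\<lambda>p. 0 \<le> p) ?q"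
    unfolding q
  proof (rule lowest_maximizer_is_arg_max)
    show "continuous_on {0..hi - lo} (\<lambda>p. p * (c * V i j p))"
      by (intro continuous_intros continuous_on_subset[OF V.cont]) simp
    show "p * (c * V i j p) \<le> 0 * (c * V i j 0)" if "hi - lo < p" for p
      using that V.vanish[of p] by simp
  qed (use bounds in simp)
  then have "0 \<le> ?q" and max: "\<And>p. 0 \<le> p \<Longrightarrow> p * (c * V i j p) \<le> ?q * (c * V i j ?q)"
    unfolding is_arg_max_def not_ex de_Morgan_conj not_less by blast+
  moreover have "p * V i j p \<le> ?q * V i j ?q" if "0 \<le> p" for p
  proof -
    have "c * (p * V i j p) \<le> c * (?q * V i j ?q)"
      using max[OF that] by (simp add: mult.left_commute)
    then show ?thesis using c by simp
  qed
  ultimately have "is_arg_max (\<lambda>p. p * V i j p) (\<lambda>p. 0 \<le> p) ?q"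
    by (simp add: is_arg_max_def not_less)
  then show ?thesis
  proof (rule V.maximizer_less_uniform_price)
    show "0 < P" by (rule benchmark_price_pos[OF P])
    then show "(P + d) * V i j d \<le> P * V i j 0" if "0 \<le> d" for d
      using that by (intro benchmark_price_V[OF P ij]) simp
  qed
qed

context
  fixes i j :: 'n
  assumes ij: "i \<noteq> j"
begin

interpretation V: log_concave_survival "V i j" "hi - lo" by (rule V_survival[OF ij])

text \<open>Nonnegativity of the cutoff is a hypothesis here because the induction proving it
  applies this lemma at each step.\<close>

lemma rich_price_is_arg_max:
  assumes d: "0 \<le> rich_price \<mu> lo hi i j s"
  shows "is_arg_max (\<lambda>p. p * max 0 (V i j p - V i j (rich_price \<mu> lo hi i j s))) (\<lambda>p. 0 \<le> p)
    (rich_price \<mu> lo hi i j (Suc s))"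
proof -
  let ?d = "rich_price \<mu> lo hi i j s"
  let ?g = "\<lambda>p. p * demand_in \<mu> i p (rich_cell lo hi i j ?d)"
  \<comment> \<open>Agreement at nonnegative prices suffices, since \<open>is_arg_max\<close>
    compares only these.\<close>
  have eq: "?g p = p * max 0 (V i j p - V i j ?d)" if "0 \<le> p" for p
    using demand_in_rich_cell[OF ij that d] by simp
  have "is_arg_max ?g (\<lambda>p. 0 \<le> p) (lowest_maximizer ?g)"
  proof (rule lowest_maximizer_is_arg_max)
    have "continuous_on {0..hi - lo} (\<lambda>p. p * max 0 (V i j p - V i j ?d))"
      using continuous_on_subset[OF V.cont subset_UNIV] by (intro continuous_intros) auto
    then show "continuous_on {0..hi - lo} ?g" by (rule continuous_on_eq) (simp add: eq)
    show "?g p \<le> ?g 0" if "hi - lo < p" for p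
      using that bounds V.vanish[of p] V.V_nonneg[OF d] by (subst eq) auto
  qed (use bounds in simp)
  then show ?thesis by (auto simp: is_arg_max_def eq)
qed

lemma rich_price_nonneg: "0 \<le> rich_price \<mu> lo hi i j s"
proof (induction s)
  case (Suc s)
  then show ?case using rich_price_is_arg_max[OF Suc] by (simp add: is_arg_max_def del: rich_price.simps)
qed (use bounds in simp)

lemmas rich_price_cutoffs =
  V.cutoff_tendsto_0[of "rich_price \<mu> lo hi i j", OF rich_price.simps(1) rich_price_is_arg_max[OF rich_price_nonneg]]
  V.cutoff_less_uniform_price[of "rich_price \<mu> lo hi i j", OF rich_price.simps(1) rich_price_is_arg_max[OF rich_price_nonneg]]

lemma rich_price_tendsto_0: "rich_price \<mu> lo hi i j \<longlonglongrightarrow> 0"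
  by (rule rich_price_cutoffs)

lemma rich_price_less_benchmark:
  assumes P: "benchmark_price \<mu> P"
  shows "rich_price \<mu> lo hi i j (Suc s) < P"
proof (rule rich_price_cutoffs)
  show "0 < P" by (rule benchmark_price_pos[OF P])
  then show "(P + d) * V i j d \<le> P * V i j 0" if "0 \<le> d" for d
    using that by (intro benchmark_price_V[OF P ij]) simp
qed

end

section \<open>Comparison of payoffs\<close>

lemma E_simple_payoff:
  assumes P: "benchmark_price \<mu> P" and E: "E_simple \<mu> lo hi \<sigma>" and t: "t \<in> T"
  shows "benchmark_payoff P b t < payoff \<sigma> t"
proof -
  let ?i = "buy \<sigma> t"
  have fav: "\<And>k. t $ k \<le> t $ ?i" and "t $ b t \<le> t $ ?i"
  proof -
    have "?i \<in> favorites UNIV t" using E t unfolding E_simple_def by blast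
    then show "\<And>k. t $ k \<le> t $ ?i" "t $ b t \<le> t $ ?i" by (simp_all add: favorites_def)
  qed
  have message: "message \<sigma> t ?i = (if t $ ?i - simple_price \<mu> ?i < best_rival t ?i then {t} else T)"
    and price: "price \<sigma> ?i {t} = max 0 (t $ ?i - best_rival t ?i)" "price \<sigma> ?i T = simple_price \<mu> ?i"
    using E t unfolding E_simple_def by blast+
  have br: "best_rival t ?i \<le> t $ ?i" using fav by (simp add: best_rival_le_iff[OF firms])
  \<comment> \<open>The type buys from a favorite, so her value is no lower than in the benchmark
    and only prices need comparing.\<close>
  have "price \<sigma> ?i (message \<sigma> t ?i) < P"
  proof (cases "t $ ?i - simple_price \<mu> ?i < best_rival t ?i")
    case True
    \<comment> \<open>A type that reveals herself to this firm pays her gap, which in this case is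
      below \<open>simple_price\<close>.\<close>
    then have "price \<sigma> ?i (message \<sigma> t ?i) = t $ ?i - best_rival t ?i"
      using br by (simp add: message price)
    then show ?thesis using True simple_price_less_benchmark[OF P, of ?i] by linarith
  next
    case False
    then have "price \<sigma> ?i (message \<sigma> t ?i) = simple_price \<mu> ?i"
      by (simp add: message price)
    then show ?thesis using simple_price_less_benchmark[OF P] by simp
  qed
  then show ?thesis using \<open>t $ b t \<le> t $ ?i\<close> by (simp add: payoff_def benchmark_payoff_def)
qed

lemma E_rich_payoff:
  assumes P: "benchmark_price \<mu> P"
    and E: "E_rich \<mu> lo hi \<sigma>" and t: "t \<in> T"
  shows "benchmark_payoff P b t < payoff \<sigma> t"
proof -
  define i j where "i = alpha t" and "j = beta t"
  have ab: "alpha t = i \<and> beta t = j" by (simp add: i_def j_def)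
  then have ij: "i \<noteq> j" and fav: "\<And>k. t $ k \<le> t $ i"
    unfolding alpha_beta_eq_iff[OF firms] by auto
  have buy: "buy \<sigma> t = i"
    using E[unfolded E_rich_def, THEN conjunct2, THEN bspec, OF t] by (simp only: i_def)
  note E_ij = E[unfolded E_rich_def, THEN conjunct1, THEN spec[of _ i], THEN spec[of _ j], THEN mp, OF ij]
  note msg = E_ij[THEN conjunct1, rule_format]
    and msg_inf = E_ij[THEN conjunct2, THEN conjunct1, rule_format]
    and price = E_ij[THEN conjunct2, THEN conjunct2, THEN conjunct1, rule_format]
    and price_inf = E_ij[THEN conjunct2, THEN conjunct2, THEN conjunct2, rule_format]
  have "price \<sigma> i (message \<sigma> t i) < P"
  proof (cases "t $ i = t $ j")
    case True
    \<comment> \<open>A tied type has gap 0, which no nonnegative cutoff undercuts; the limiting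
      message serves her at price 0.\<close>
    then have "t \<in> rich_msg_inf lo hi i j" using t ab by (simp add: rich_msg_inf_def)
    then have "price \<sigma> i (message \<sigma> t i) = 0" by (simp only: msg_inf price_inf)
    then show ?thesis using benchmark_price_pos[OF P] by simp
  next
    case False
    let ?r = "rich_price \<mu> lo hi i j"
    let ?gap = "t $ i - t $ j"
    have "0 < ?gap" using False fav[of j] by simp
    then obtain s0 where "?r s0 < ?gap"
      using order_tendstoD(2)[OF rich_price_tendsto_0[OF ij]] unfolding eventually_sequentially by blast
    \<comment> \<open>The first cutoff below the gap: the one before it is at least the gap, so
      \<open>t\<close> belongs to message \<open>s\<close> and pays \<open>?r s\<close>.\<close>
    define s where "s = (LEAST s. ?r s < ?gap)"
    have s: "?r s < ?gap" unfolding s_def by (rule LeastI[of "\<lambda>s. ?r s < ?gap", OF \<open>?r s0 < ?gap\<close>])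
    have s_least: "?gap \<le> ?r s'" if "s' < s" for s'
      using not_less_Least[of s' "\<lambda>s. ?r s < ?gap"] that unfolding s_def by simp
    have "t $ i \<le> hi" "lo \<le> t $ j" using t by (simp_all add: mem_T_iff)
    then have "?gap \<le> hi - lo" by simp
    \<comment> \<open>The cutoff of index 0 is \<open>hi - lo\<close>, which is never below a gap,
      so \<open>s\<close> is an index for which a message exists.\<close>
    then have "s \<noteq> 0" using s by (intro notI) simp
    then obtain s' where s': "s = Suc s'" using not0_implies_Suc by blast
    have "t \<in> rich_msg \<mu> lo hi i j s"
      using s_least[of s'] t ab by (simp add: rich_msg_def rich_cell_def s')
    then have "message \<sigma> t i = rich_msg \<mu> lo hi i j s" using s \<open>s \<noteq> 0\<close> by (intro msg) simp_all
    then have "price \<sigma> i (message \<sigma> t i) = ?r s" using price[of s i] \<open>s \<noteq> 0\<close> by simp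
    then show ?thesis unfolding s' using rich_price_less_benchmark[OF ij P] by (simp only:)
  qed
  then show ?thesis using fav[of "b t"] by (simp add: payoff_def benchmark_payoff_def buy)
qed

end

theorem proposition11:
  fixes lo hi pstar :: real
    and f :: "real ^ 'n::{finite,linorder} \<Rightarrow> real"
    and \<mu> :: "(real ^ 'n::{finite,linorder}) measure"
    and buy0 :: "real ^ 'n::{finite,linorder} \<Rightarrow> 'n::{finite,linorder}"
  assumes firms: "CARD('n::{finite,linorder}) \<ge> 2"
    and bounds: "0 < lo" "lo < hi"
    and f_pos: "\<forall>t\<in>type_space lo hi. 0 < f t"
    and f_cont: "continuous_on (type_space lo hi) f"
    and mu_density: "\<mu> = density lborel (\<lambda>t. ennreal (f t) * indicator (type_space lo hi) t)"
    and mu_prob: "prob_space \<mu>"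
    and f_symmetric: "symmetric_on (type_space lo hi) f"
    and f_log_concave: "concave_on (type_space lo hi) (\<lambda>t. ln (f t))"
    and pstar: "benchmark_price \<mu> pstar"
    and buy0: "\<forall>t\<in>type_space lo hi. buy0 t \<in> favorites UNIV t"
  shows "(\<forall>\<sigma>. E_simple \<mu> lo hi \<sigma> \<longrightarrow>
           (\<forall>t\<in>type_space lo hi. payoff \<sigma> t > benchmark_payoff pstar buy0 t)) \<and>
         (\<forall>\<sigma>. E_rich \<mu> lo hi \<sigma> \<longrightarrow>
           (\<forall>t\<in>type_space lo hi. payoff \<sigma> t > benchmark_payoff pstar buy0 t))"
proof -
  interpret oligopoly lo hi f \<mu>
    by (rule oligopoly.intro) (fact assms)+
  show ?thesis using E_simple_payoff[OF pstar] E_rich_payoff[OF pstar] by blast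
qed

end
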